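(* There exist a tournament $T$ on 8 vertices with score sequence $(1,3,3,3,3,4,5,6)$ that is intrinsically linked as a directed graph, and a tournament $T'$ on 8 vertices with the same score sequence $(1,3,3,3,3,4,5,6)$ that has an embedding into $S^3$ with no consistently oriented non-split link.
   Context: A tournament is a directed graph with exactly one directed edge between each pair of distinct vertices. Its score sequence is the list of outdegrees of its vertices in non-decreasing order. A cycle in a directed graph is consistently oriented if it is a directed cycle; a consistently oriented link in an embedded directed graph is a pair of vertex-disjoint consistently oriented cycles. A directed graph $G$ is intrinsically linked as a directed graph if every (tame) embedding of $G$ into $S^3$ contains a consistently oriented link that is non-split. *)

theory Defs
  imports "HOL-Analysis.Analysis" "HOL-Library.Multiset" "Graph_Theory.Arc_Walk"
begin

section \<open>Tournaments\<close>

text \<open>The locale predicate \<open>digraph\<close> already excludes loops and parallel arcs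
  and requires finitely many vertices.\<close>

definition tournament :: "('a, 'b) pre_digraph \<Rightarrow> bool" where
  "tournament G \<longleftrightarrow> digraph G \<and>
     (\<forall>u \<in> verts G. \<forall>v \<in> verts G. u \<noteq> v \<longrightarrow>
        (\<exists>!e. e \<in> arcs G \<and>
           (tail G e = u \<and> head G e = v \<or> tail G e = v \<and> head G e = u)))"

definition score_sequence :: "('a, 'b) pre_digraph \<Rightarrow> nat list" where
  "score_sequence G = sorted_list_of_multiset (image_mset (out_degree G) (mset_set (verts G)))"


section \<open>Tame subsets of the 3-sphere\<close>

abbreviation S3 :: "(real ^ 4) set" where
  "S3 \<equiv> sphere 0 1"

text \<open>A one-dimensional subset of the 3-sphere is tame if some homeomorphism of the 3-sphere onto
  \<open>\<real>\<^sup>3 \<union> {\<infinity>}\<close> takes it to a finite union of straight segments in \<open>\<real>\<^sup>3\<close>. Such a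
  homeomorphism is the same thing as a point \<open>p\<close>, the preimage of \<open>\<infinity>\<close>, together with a
  homeomorphism from the complement of \<open>p\<close> onto \<open>\<real>\<^sup>3\<close>.\<close>

definition tame_1dim :: "(real ^ 4) set \<Rightarrow> bool" where
  "tame_1dim X \<longleftrightarrow>
     (\<exists>p h k. p \<in> S3 \<and> X \<subseteq> S3 - {p} \<and>
        homeomorphism (S3 - {p}) (UNIV :: (real ^ 3) set) h k \<and>
        (\<exists>F. finite F \<and> h ` X = (\<Union>(a, b) \<in> F. closed_segment a b)))"

text \<open>A 2-sphere in the 3-sphere is tame if it is ambiently homeomorphic to a great 2-sphere.
  By Bing's approximation theorem, admitting wild 2-spheres as well would not make more links
  split.\<close>

definition tame_2sphere :: "(real ^ 4) set \<Rightarrow> bool" where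
  "tame_2sphere \<Sigma> \<longleftrightarrow> (\<exists>h k. homeomorphism S3 S3 h k \<and> \<Sigma> = h ` {x \<in> S3. x $ 4 = 0})"

definition split_link :: "(real ^ 4) set \<Rightarrow> (real ^ 4) set \<Rightarrow> bool" where
  "split_link A B \<longleftrightarrow>
     (\<exists>\<Sigma>. tame_2sphere \<Sigma> \<and> A \<subseteq> S3 - \<Sigma> \<and> B \<subseteq> S3 - \<Sigma> \<and>
        (\<forall>a \<in> A. \<forall>b \<in> B. \<not> connected_component (S3 - \<Sigma>) a b))"


section \<open>Spatial embeddings of digraphs\<close>

text \<open>An embedding of the geometric realization is given by the positions \<open>\<phi>\<close> of the vertices
  and a parametrization \<open>\<gamma> e\<close> of each arc \<open>e\<close>. A \<open>simple_path\<close> may be closed, so loops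
  are covered; since \<open>\<phi>\<close> is injective, every other arc is embedded injectively.\<close>

definition spatial_embedding ::
  "('a, 'b) pre_digraph \<Rightarrow> ('a \<Rightarrow> real ^ 4) \<Rightarrow> ('b \<Rightarrow> real \<Rightarrow> real ^ 4) \<Rightarrow> bool" where
  "spatial_embedding G \<phi> \<gamma> \<longleftrightarrow>
     inj_on \<phi> (verts G) \<and> \<phi> ` verts G \<subseteq> S3 \<and>
     (\<forall>e \<in> arcs G.
        simple_path (\<gamma> e) \<and> path_image (\<gamma> e) \<subseteq> S3 \<and>
        pathstart (\<gamma> e) = \<phi> (tail G e) \<and> pathfinish (\<gamma> e) = \<phi> (head G e) \<and>
        path_image (\<gamma> e) \<inter> \<phi> ` verts G = {\<phi> (tail G e), \<phi> (head G e)}) \<and>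
     (\<forall>e \<in> arcs G. \<forall>f \<in> arcs G. e \<noteq> f \<longrightarrow>
        path_image (\<gamma> e) \<inter> path_image (\<gamma> f) \<subseteq> \<phi> ` verts G)"

definition tame_embedding ::
  "('a, 'b) pre_digraph \<Rightarrow> ('a \<Rightarrow> real ^ 4) \<Rightarrow> ('b \<Rightarrow> real \<Rightarrow> real ^ 4) \<Rightarrow> bool" where
  "tame_embedding G \<phi> \<gamma> \<longleftrightarrow> spatial_embedding G \<phi> \<gamma> \<and>
     tame_1dim (\<phi> ` verts G \<union> (\<Union>e \<in> arcs G. path_image (\<gamma> e)))"

definition embedded_cycle :: "('b \<Rightarrow> real \<Rightarrow> real ^ 4) \<Rightarrow> 'b list \<Rightarrow> (real ^ 4) set" where
  "embedded_cycle \<gamma> c = (\<Union>e \<in> set c. path_image (\<gamma> e))"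

text \<open>\<open>pre_digraph.cycle\<close> is the notion of a directed cycle, as the list of its arcs.
  Its vertices are the tails of these arcs.\<close>

definition consistent_link :: "('a, 'b) pre_digraph \<Rightarrow> 'b list \<Rightarrow> 'b list \<Rightarrow> bool" where
  "consistent_link G c d \<longleftrightarrow> pre_digraph.cycle G c \<and> pre_digraph.cycle G d \<and>
     tail G ` set c \<inter> tail G ` set d = {}"

definition has_nonsplit_consistent_link ::
  "('a, 'b) pre_digraph \<Rightarrow> ('b \<Rightarrow> real \<Rightarrow> real ^ 4) \<Rightarrow> bool" where
  "has_nonsplit_consistent_link G \<gamma> \<longleftrightarrow>
     (\<exists>c d. consistent_link G c d \<and> \<not> split_link (embedded_cycle \<gamma> c) (embedded_cycle \<gamma> d))"

definition intrinsically_linked_digraph :: "('a, 'b) pre_digraph \<Rightarrow> bool" where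
  "intrinsically_linked_digraph G \<longleftrightarrow>
     (\<forall>\<phi> \<gamma>. tame_embedding G \<phi> \<gamma> \<longrightarrow> has_nonsplit_consistent_link G \<gamma>)"

end

theory Submission
  imports Defs "HOL-Library.Z2"
begin

text \<open>Both tournaments are explicit.

Intrinsic linking rests on linking numbers modulo 2, in the manner of the theorem of Sachs and
Conway-Gordon for \<open>K\<^sub>6\<close>. A homeomorphism of a punctured 3-sphere with \<open>\<real>\<^sup>3\<close> carries the
embedded tournament to paths in \<open>\<real>\<^sup>3\<close>, and these are approximated by rectilinear chains in
general position (\<open>polygonal_approximation\<close>). For arcs \<open>e\<close> and \<open>f\<close> without common vertex let \<open>lk e f\<close> be the
parity of the crossings at which the chain of \<open>e\<close> passes over the chain of \<open>f\<close>. Two facts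
carry the argument.

First, if two disjoint cycles are split by a tame sphere, then one of the two complementary open
balls is a contractible open set that contains one of the cycles, misses the other and also misses
the puncture (\<open>split_link_contractible\<close>). Contracting the one cycle in this ball sweeps out a grid
of small triangles, each of which has linking parity zero with the other cycle, and so the linking
parity of the two cycles vanishes (\<open>lk_contractible\<close>).

Second, \<open>lk e f + lk f e\<close> is the parity of all crossings of \<open>e\<close> and \<open>f\<close>. In the plane this depends
on the embedding only through terms attached to the end points (\<open>lk_swap_sum\<close>), and these terms
cancel in the sum over a closed cycle. After subtracting them, an embedding gives a function \<open>Z\<close> on
pairs of arcs for which \<open>Z e f + Z f e\<close> is the parity that \<open>e\<close> and \<open>f\<close> would have as chords of a
convex polygon with the vertices in their natural order, and for which the sum of \<open>Z\<close> over the arc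
pairs of any split link is zero (\<open>overcrossing_parities_of_split_links\<close>). For one tournament there
are 28 pairs of disjoint directed cycles such that every unordered pair of arcs is met an even number
of times, whereas the constants coming from \<open>Z e f + Z f e\<close> add up to 1. Hence not all of these 28
links are split.

In the other tournament every pair of disjoint directed cycles has the triangle on \<open>1, 3, 4\<close> as
one of its members (\<open>cycle_avoiding_2\<close>). The vertices are put on the moment curve, where straight
segments do not meet unless they have to, with the triangle on one side of a plane and the
remaining vertices on the other. Stereographic projection turns this plane into the great sphere
that splits all links.\<close>

section \<open>Arithmetic modulo two\<close>

text \<open>Ring normal forms are the ones that make equal summands cancel; the default rewriting into bit
operations would destroy them.\<close>

declare add_bit_eq_xor [simp del] mult_bit_eq_and [simp del]

lemma bit_add_self [simp]: "a + a = (0 :: bit)"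
  by (cases a) simp_all

lemma bit_add_left_self [simp]: "a + (a + b) = (b :: bit)"
  by (cases a; cases b) simp_all

lemma bit_add_eq_0_iff: "a + b = 0 \<longleftrightarrow> a = (b :: bit)"
  by (cases a; cases b) simp_all

lemma sum_list_swap:
  fixes f :: "'a \<Rightarrow> 'b \<Rightarrow> 'c :: comm_monoid_add"
  shows "(\<Sum>x\<leftarrow>xs. \<Sum>y\<leftarrow>ys. f x y) = (\<Sum>y\<leftarrow>ys. \<Sum>x\<leftarrow>xs. f x y)"
  by (induction xs) (simp_all add: sum_list_addf)

section \<open>Rectilinear chains and their crossings\<close>

text \<open>A step \<open>(p, q)\<close> stands for the rectilinear path from \<open>p\<close> to \<open>q\<close> that runs parallel to the first, then to
the second and finally to the third axis. Projected along the third axis, two such paths in general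
position cross where a part along the first axis meets one along the second, and both of these parts
lie at the height of the initial point. All crossings are thus decided by comparing coordinates.\<close>

type_synonym step = "(real ^ 3) \<times> (real ^ 3)"

definition lt :: "real \<Rightarrow> real \<Rightarrow> bit" where
  "lt a b = of_bool (a < b)"

text \<open>The first product is for the part of \<open>s\<close> along the first axis and the part of \<open>t\<close> along the second
axis, the second product for the reverse situation. Other parts are parallel in the projection or
project to points.\<close>

definition crossing :: "step \<Rightarrow> step \<Rightarrow> bit" where
  "crossing s t =
     (lt (snd t $ 1) (fst s $ 1) + lt (snd t $ 1) (snd s $ 1)) *
     (lt (fst s $ 2) (fst t $ 2) + lt (fst s $ 2) (snd t $ 2)) +
     (lt (snd s $ 1) (fst t $ 1) + lt (snd s $ 1) (snd t $ 1)) *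
     (lt (fst t $ 2) (fst s $ 2) + lt (fst t $ 2) (snd s $ 2))"

definition overcrossing :: "step \<Rightarrow> step \<Rightarrow> bit" where
  "overcrossing s t = lt (fst t $ 3) (fst s $ 3) * crossing s t"

text \<open>The parity of the crossings of the projection of \<open>s\<close> with the ray that starts at \<open>w\<close> in the positive
direction of the first axis.\<close>

definition ray :: "step \<Rightarrow> real ^ 3 \<Rightarrow> bit" where
  "ray s w = lt (w $ 1) (snd s $ 1) * (lt (w $ 2) (fst s $ 2) + lt (w $ 2) (snd s $ 2))"

definition rays :: "step list \<Rightarrow> real ^ 3 \<Rightarrow> bit" where
  "rays c w = (\<Sum>s\<leftarrow>c. ray s w)"

text \<open>Boundaries modulo 2 are handled through test functions: a chain is closed if every point is an end
of an even number of steps, that is, if all functions have sum zero over the ends of its steps.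
This makes telescoping arguments independent of any order of the steps.\<close>

definition boundary :: "step list \<Rightarrow> (real ^ 3 \<Rightarrow> bit) \<Rightarrow> bit" where
  "boundary c g = (\<Sum>s\<leftarrow>c. g (fst s) + g (snd s))"

definition closed_chain :: "step list \<Rightarrow> bool" where
  "closed_chain c \<longleftrightarrow> (\<forall>g. boundary c g = 0)"

definition lk :: "step list \<Rightarrow> step list \<Rightarrow> bit" where
  "lk c d = (\<Sum>s\<leftarrow>c. \<Sum>t\<leftarrow>d. overcrossing s t)"

definition apart :: "real ^ 3 \<Rightarrow> real ^ 3 \<Rightarrow> bool" where
  "apart x y \<longleftrightarrow> (\<forall>k. x $ k \<noteq> y $ k)"

definition corners :: "step list \<Rightarrow> (real ^ 3) set" where
  "corners c = fst ` set c \<union> snd ` set c"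

definition generic :: "step list \<Rightarrow> step list \<Rightarrow> bool" where
  "generic c d \<longleftrightarrow> (\<forall>x\<in>corners c. \<forall>y\<in>corners d. apart x y)"

lemma apart_sym: "apart x y \<longleftrightarrow> apart y x"
  by (metis apart_def)

lemma generic_sym: "generic c d \<longleftrightarrow> generic d c"
  by (metis apart_sym generic_def)

lemma generic_step:
  assumes "generic c d" "s \<in> set c" "t \<in> set d"
  shows "apart (fst s) (fst t)" "apart (fst s) (snd t)" "apart (snd s) (fst t)" "apart (snd s) (snd t)"
  using assms unfolding generic_def corners_def by blast+

lemma lt_swap: "a \<noteq> b \<Longrightarrow> lt b a = 1 + lt a b"
  by (auto simp: lt_def)

lemma crossing_sym: "crossing s t = crossing t s"
  by (simp add: crossing_def add.commute)

text \<open>Each part of \<open>t\<close> along the second axis is crossed by \<open>s\<close> as often as the rays from its two ends are,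
up to the contribution of the ends of \<open>s\<close>, which see \<open>t\<close> in the opposite direction. Turning this
direction around adds the crossings of \<open>t\<close> with a full line parallel to the first axis, and these
depend only on the second coordinates of the ends of \<open>t\<close>.\<close>

lemma crossing_boundary:
  assumes "apart (fst s) (fst t)" "apart (fst s) (snd t)" "apart (snd s) (fst t)" "apart (snd s) (snd t)"
  shows "crossing s t = (ray s (fst t) + ray s (snd t)) + (ray t (fst s) + ray t (snd s)) +
     (lt (fst s $ 2) (fst t $ 2) + lt (fst s $ 2) (snd t $ 2) +
     (lt (snd s $ 2) (fst t $ 2) + lt (snd s $ 2) (snd t $ 2)))"
proof -
  obtain p q where s: "s = (p, q)" by fastforce
  obtain u v where t: "t = (u, v)" by fastforce
  have sw: "lt (u $ i) (p $ i) = 1 + lt (p $ i) (u $ i)" "lt (v $ i) (p $ i) = 1 + lt (p $ i) (v $ i)"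
     "lt (u $ i) (q $ i) = 1 + lt (q $ i) (u $ i)" "lt (v $ i) (q $ i) = 1 + lt (q $ i) (v $ i)" for i
    using assms by (auto intro!: lt_swap simp: apart_def s t)
  show ?thesis
    unfolding crossing_def ray_def s t fst_conv snd_conv sw
    by (simp add: algebra_simps)
qed

lemma overcrossing_swap:
  assumes "apart (fst s) (fst t)"
  shows "overcrossing s t + overcrossing t s = crossing s t"
proof -
  have "lt (fst s $ 3) (fst t $ 3) = 1 + lt (fst t $ 3) (fst s $ 3)"
    using assms by (intro lt_swap) (metis apart_def)
  then show ?thesis
    by (simp add: overcrossing_def crossing_sym[of t s] distrib_right)
qed

lemma boundary_single: "boundary [t] g = g (fst t) + g (snd t)"
  by (simp add: boundary_def)

text \<open>For closed chains all three terms on the right vanish: closed curves in the plane cross an even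
number of times.\<close>

lemma total_crossing:
  assumes g: "generic c d"
  shows "(\<Sum>s\<leftarrow>c. \<Sum>t\<leftarrow>d. crossing s t) =
    boundary d (rays c) + boundary c (rays d) + boundary c (\<lambda>x. boundary d (\<lambda>y. lt (x $ 2) (y $ 2)))"
proof -
  have "(\<Sum>s\<leftarrow>c. \<Sum>t\<leftarrow>d. crossing s t) = (\<Sum>s\<leftarrow>c. \<Sum>t\<leftarrow>d. (ray s (fst t) + ray s (snd t)) + (ray t (fst s) + ray t (snd s)) +
     (lt (fst s $ 2) (fst t $ 2) + lt (fst s $ 2) (snd t $ 2) +
     (lt (snd s $ 2) (fst t $ 2) + lt (snd s $ 2) (snd t $ 2))))"
    using generic_step[OF g] by (intro arg_cong[of _ _ sum_list] map_cong refl crossing_boundary) auto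
  also have "\<dots> = (\<Sum>s\<leftarrow>c. \<Sum>t\<leftarrow>d. ray s (fst t) + ray s (snd t)) +
     (\<Sum>s\<leftarrow>c. \<Sum>t\<leftarrow>d. ray t (fst s) + ray t (snd s)) +
     boundary c (\<lambda>x. boundary d (\<lambda>y. lt (x $ 2) (y $ 2)))"
    by (simp add: boundary_def sum_list_addf)
  also have "(\<Sum>s\<leftarrow>c. \<Sum>t\<leftarrow>d. ray s (fst t) + ray s (snd t)) = boundary d (rays c)"
    by (subst sum_list_swap) (simp add: boundary_def rays_def sum_list_addf)
  also have "(\<Sum>s\<leftarrow>c. \<Sum>t\<leftarrow>d. ray t (fst s) + ray t (snd s)) = boundary c (rays d)"
    by (simp add: boundary_def rays_def sum_list_addf)
  finally show ?thesis .
qed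

lemma lk_swap_sum:
  assumes g: "generic c d"
  shows "lk c d + lk d c =
    boundary d (rays c) + boundary c (rays d) + boundary c (\<lambda>x. boundary d (\<lambda>y. lt (x $ 2) (y $ 2)))"
proof -
  have "lk c d + lk d c = (\<Sum>s\<leftarrow>c. \<Sum>t\<leftarrow>d. overcrossing s t) + (\<Sum>s\<leftarrow>c. \<Sum>t\<leftarrow>d. overcrossing t s)"
    unfolding lk_def by (subst (3) sum_list_swap) simp
  also have "\<dots> = (\<Sum>s\<leftarrow>c. \<Sum>t\<leftarrow>d. overcrossing s t + overcrossing t s)"
    by (simp add: sum_list_addf)
  also have "\<dots> = (\<Sum>s\<leftarrow>c. \<Sum>t\<leftarrow>d. crossing s t)"
    using generic_step[OF g] by (intro arg_cong[of _ _ sum_list] map_cong refl overcrossing_swap) auto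
  finally show ?thesis
    using total_crossing[OF g] by simp
qed

corollary lk_commute:
  assumes "generic c d" "closed_chain c" "closed_chain d"
  shows "lk c d = lk d c"
  using lk_swap_sum[OF assms(1)] assms(2,3)
  by (simp add: closed_chain_def bit_add_eq_0_iff)

text \<open>A coordinate in which \<open>t\<close> is separated from \<open>P\<close> keeps the whole rectilinear path of \<open>t\<close> away from
the bounding box of \<open>P\<close>.\<close>

definition on_one_side :: "3 \<Rightarrow> (real ^ 3) set \<Rightarrow> step \<Rightarrow> bool" where
  "on_one_side k P t \<longleftrightarrow>
     (\<forall>x\<in>P. x $ k < fst t $ k \<and> x $ k < snd t $ k) \<or> (\<forall>x\<in>P. fst t $ k < x $ k \<and> snd t $ k < x $ k)"

lemma corners_step: "s \<in> set c \<Longrightarrow> fst s \<in> corners c" "s \<in> set c \<Longrightarrow> snd s \<in> corners c"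
  by (auto simp: corners_def)

text \<open>A point outside the bounding box of the projection of a closed chain has winding parity zero.\<close>

lemma rays_eq_0:
  assumes cl: "closed_chain c" and k: "k = 1 \<or> k = 2"
    and sep: "(\<forall>x\<in>corners c. x $ k < w $ k) \<or> (\<forall>x\<in>corners c. w $ k < x $ k)"
  shows "rays c w = 0"
proof (cases "k = 1 \<and> (\<forall>x\<in>corners c. w $ k < x $ k)")
  case True
  \<comment> \<open>The chain lies beyond the starting point of the ray, so that only heights matter.\<close>
  have "rays c w = boundary c (\<lambda>x. lt (w $ 2) (x $ 2))"
    unfolding rays_def boundary_def ray_def
    using True by (intro arg_cong[of _ _ sum_list] map_cong refl) (auto simp: lt_def dest!: corners_step)
  then show ?thesis
    using cl by (simp add: closed_chain_def)
next
  case False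
  have "ray s w = 0" if "s \<in> set c" for s
  proof -
    have "(fst s $ k < w $ k \<and> snd s $ k < w $ k) \<or> (k = 2 \<and> w $ k < fst s $ k \<and> w $ k < snd s $ k)"
      using False k sep corners_step[OF that] by blast
    then show ?thesis
      using k by (auto simp: ray_def lt_def)
  qed
  then show ?thesis
    unfolding rays_def by (simp cong: map_cong)
qed

lemma on_one_side_step:
  assumes "on_one_side k (corners c) t" "s \<in> set c"
  shows "(fst s $ k < fst t $ k \<and> fst s $ k < snd t $ k \<and> snd s $ k < fst t $ k \<and> snd s $ k < snd t $ k) \<or>
    (fst t $ k < fst s $ k \<and> snd t $ k < fst s $ k \<and> fst t $ k < snd s $ k \<and> snd t $ k < snd s $ k)"
  using assms corners_step[OF assms(2)] unfolding on_one_side_def by blast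

text \<open>If \<open>t\<close> lies above or below \<open>c\<close>, then it is crossed over by \<open>c\<close> never or at every crossing of the projections,
and these are counted by the winding parities at the ends of \<open>t\<close>. If \<open>t\<close> lies to
one side of \<open>c\<close> in the projection, all terms vanish. In both cases the count is a difference of
values of a single function at the two ends, which is what summation over a closed chain needs.\<close>

lemma overcrossing_separated_step:
  assumes cl: "closed_chain c" and gen: "generic c [t]" and x: "x \<in> corners c"
    and sep: "on_one_side k (corners c) t"
  defines "g \<equiv> \<lambda>w. lt (w $ 3) (x $ 3) * rays c w"
  shows "(\<Sum>s\<leftarrow>c. overcrossing s t) = g (fst t) + g (snd t)"
proof -
  consider "k = 1" | "k = 2" | "k = 3"
    using exhaust_3[of k] by blast
  then show ?thesis
  proof cases
    case 3
    define b where "b = lt (fst t $ 3) (x $ 3)"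
    have b: "b = lt (snd t $ 3) (x $ 3)"
      using sep x unfolding 3 b_def lt_def on_one_side_def by fastforce
    have "lt (fst t $ 3) (fst s $ 3) = b" if "s \<in> set c" for s
      using sep x corners_step(1)[OF that] unfolding 3 b_def lt_def on_one_side_def by fastforce
    then have "(\<Sum>s\<leftarrow>c. overcrossing s t) = b * (\<Sum>s\<leftarrow>c. crossing s t)"
      by (simp add: overcrossing_def sum_list_const_mult cong: map_cong)
    also have "(\<Sum>s\<leftarrow>c. crossing s t) = rays c (fst t) + rays c (snd t)"
      using total_crossing[OF gen] cl by (simp add: closed_chain_def boundary_single)
    finally show ?thesis
      using b by (simp add: g_def b_def distrib_left)
  next
    case 1
    have "overcrossing s t = 0" if "s \<in> set c" for s
      using on_one_side_step[OF sep that] unfolding 1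
      by (elim disjE conjE) (simp_all add: overcrossing_def crossing_def lt_def)
    moreover have "rays c (fst t) = 0" "rays c (snd t) = 0"
      using sep 1 by (auto intro!: rays_eq_0[OF cl, of 1] simp: on_one_side_def)
    ultimately show ?thesis
      by (simp add: g_def cong: map_cong)
  next
    case 2
    have "overcrossing s t = 0" if "s \<in> set c" for s
      using on_one_side_step[OF sep that] unfolding 2
      by (elim disjE conjE) (simp_all add: overcrossing_def crossing_def lt_def)
    moreover have "rays c (fst t) = 0" "rays c (snd t) = 0"
      using sep 2 by (auto intro!: rays_eq_0[OF cl, of 2] simp: on_one_side_def)
    ultimately show ?thesis
      by (simp add: g_def cong: map_cong)
  qed
qed

lemma lk_separated:
  assumes cl: "closed_chain c" "closed_chain d" and gen: "generic c d"
    and sep: "\<And>t. t \<in> set d \<Longrightarrow> \<exists>k. on_one_side k (corners c) t"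
  shows "lk c d = 0"
proof (cases "c = []")
  case True
  then show ?thesis by (simp add: lk_def)
next
  case False
  then obtain x where x: "x \<in> corners c"
    by (force simp: corners_def neq_Nil_conv)
  define g where "g = (\<lambda>w. lt (w $ 3) (x $ 3) * rays c w)"
  have "(\<Sum>s\<leftarrow>c. overcrossing s t) = g (fst t) + g (snd t)" if "t \<in> set d" for t
  proof -
    have "generic c [t]"
      using gen that by (auto simp: generic_def corners_def)
    with sep[OF that] x show ?thesis
      unfolding g_def using overcrossing_separated_step[OF cl(1)] by blast
  qed
  then have "lk c d = boundary d g"
    unfolding lk_def boundary_def by (subst sum_list_swap) (simp cong: map_cong)
  then show ?thesis
    using cl(2) by (simp add: closed_chain_def)
qed

section \<open>Contractible chains are unlinked\<close>

text \<open>Some coordinate carries a third of the distance of \<open>p\<close> and \<open>u\<close>, hence at least \<open>2 * e\<close>, and the other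
points deviate from \<open>p\<close> and \<open>u\<close> by less than \<open>e\<close>.\<close>

lemma triangle_on_one_side:
  fixes p q r :: "real ^ 3"
  assumes "dist p q < e" "dist p r < e" "dist u v < e" "6 * e \<le> dist p u"
  shows "\<exists>k. on_one_side k {p, q, r} (u, v)"
proof -
  have "\<exists>k. 2 * e \<le> \<bar>p $ k - u $ k\<bar>"
  proof (rule ccontr)
    assume "\<nexists>k. 2 * e \<le> \<bar>p $ k - u $ k\<bar>"
    then have "\<bar>p $ k - u $ k\<bar> < 2 * e" for k
      by (meson not_le)
    from this[of 1] this[of 2] this[of 3] have "(\<Sum>k\<in>UNIV. \<bar>(p - u) $ k\<bar>) < 6 * e"
      by (simp add: sum_3)
    then show False
      using norm_le_l1_cart[of "p - u"] assms(4) by (simp add: dist_norm)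
  qed
  then obtain k where k: "2 * e \<le> \<bar>p $ k - u $ k\<bar>"
    by blast
  have "\<bar>x $ k - y $ k\<bar> < e" if "dist x y < e" for x y :: "real ^ 3"
    using component_le_norm_cart[of "x - y" k] that by (simp add: dist_norm)
  note c = this[OF assms(1)] this[OF assms(2)] this[OF assms(3)]
  have "on_one_side k {p, q, r} (u, v)"
    using k c unfolding on_one_side_def by (cases "p $ k < u $ k") auto
  then show ?thesis ..
qed

text \<open>The linking parity with \<open>d\<close>, as a function of a single step, is a cocycle on small triangles far from \<open>d\<close>.\<close>

lemma lk_triangle:
  fixes p q r :: "real ^ 3"
  assumes d: "closed_chain d" and gen: "\<And>x y. x \<in> {p, q, r} \<Longrightarrow> y \<in> corners d \<Longrightarrow> apart x y"
    and small: "dist p q < e" "dist p r < e"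
    and far: "\<And>t. t \<in> set d \<Longrightarrow> 6 * e \<le> dist p (fst t) \<and> dist (fst t) (snd t) < e"
  shows "lk [(p, q)] d + lk [(q, r)] d + lk [(r, p)] d = 0"
proof -
  let ?c = "[(p, q), (q, r), (r, p)]"
  have cor: "corners ?c = {p, q, r}"
    by (auto simp: corners_def)
  have "lk ?c d = 0"
  proof (rule lk_separated[OF _ d])
    show "closed_chain ?c"
      by (simp add: closed_chain_def boundary_def algebra_simps)
    show "generic ?c d"
      using gen unfolding generic_def cor by blast
    fix t assume "t \<in> set d"
    then show "\<exists>k. on_one_side k (corners ?c) t"
      using triangle_on_one_side[OF small, of "fst t" "snd t"] far[of t] unfolding cor by simp
  qed
  then show ?thesis
    by (simp add: lk_def add.assoc)
qed

text \<open>Two triangles with a common side \<open>c\<close> give a relation between the four sides of a quadrilateral.\<close>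

lemma bit_two_triangles: "a + b + c = 0 \<Longrightarrow> a' + b' + c = 0 \<Longrightarrow> a + b' = a' + (b :: bit)"
  by (cases a; cases b; cases c; cases a'; cases b') simp_all

text \<open>Only the initial points are required to be close to \<open>A\<close>; together with the bound on the length of
the steps this controls both ends.\<close>

definition fine_near :: "real \<Rightarrow> (real ^ 3) set \<Rightarrow> step list \<Rightarrow> bool" where
  "fine_near e A c \<longleftrightarrow> (\<forall>s\<in>set c. (\<exists>a\<in>A. dist a (fst s) < e) \<and> dist (fst s) (snd s) < e)"

lemma exists_apart_near:
  fixes x :: "real ^ 3"
  assumes "finite Y" "e > 0"
  shows "\<exists>x'. dist x x' < e \<and> (\<forall>y\<in>Y. apart x' y)"
proof -
  have "\<exists>r. x $ k < r \<and> r < x $ k + e / 3 \<and> r \<notin> (\<lambda>y. y $ k) ` Y" for k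
  proof -
    have "infinite {x $ k <..< x $ k + e / 3}"
      using assms(2) by (simp add: infinite_Ioo)
    then have "\<not> {x $ k <..< x $ k + e / 3} \<subseteq> (\<lambda>y. y $ k) ` Y"
      using assms(1) finite_subset by blast
    then show ?thesis
      by (meson greaterThanLessThan_iff subsetI)
  qed
  then obtain r where r: "\<And>k. x $ k < r k \<and> r k < x $ k + e / 3 \<and> r k \<notin> (\<lambda>y. y $ k) ` Y"
    by metis
  define x' where "x' = (\<chi> k. r k)"
  have "dist x x' \<le> (\<Sum>k\<in>UNIV. \<bar>(x - x') $ k\<bar>)"
    unfolding dist_norm by (rule norm_le_l1_cart)
  also have "\<dots> < e"
    using r[of 1] r[of 2] r[of 3] by (simp add: sum_3 x'_def)
  finally have "dist x x' < e" .
  moreover have "\<forall>y\<in>Y. apart x' y"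
    unfolding apart_def x'_def using r by (metis image_eqI vec_lambda_beta)
  ultimately show ?thesis by blast
qed

lemma finite_corners: "finite (corners c)"
  by (simp add: corners_def)

lemma lk_eq_sum: "lk c d = (\<Sum>s\<leftarrow>c. lk [s] d)"
  by (induction c) (simp_all add: lk_def)

text \<open>A contraction of \<open>W\<close> moves a step of \<open>c\<close> to a degenerate step through finitely many intermediate
positions. Consecutive positions span a small quadrilateral, and the cocycle property of the linking
parity lets its value change only by contributions of the two trajectories. Hence the linking parity
of a step with \<open>d\<close> is the sum of the values at its ends of a function \<open>f n\<close>, and it sums to zero over
a closed chain.\<close>

proposition lk_contractible:
  fixes A B W :: "(real ^ 3) set"
  assumes W: "open W" "contractible W" and A: "compact A" "A \<noteq> {}" "A \<subseteq> W"
    and B: "compact B" "W \<inter> B = {}"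
  obtains e where "e > 0"
    "\<And>c d. closed_chain c \<Longrightarrow> closed_chain d \<Longrightarrow> generic c d \<Longrightarrow>
       fine_near e A c \<Longrightarrow> fine_near e B d \<Longrightarrow> lk c d = 0"
proof -
  obtain a where "homotopic_with_canon (\<lambda>x. True) W W id (\<lambda>x. a)"
    using W(2) unfolding contractible_def by blast
  then obtain H :: "real \<times> (real ^ 3) \<Rightarrow> real ^ 3" where contH: "continuous_on ({0..1} \<times> W) H" and "H \<in> {0..1} \<times> W \<rightarrow> W"
    and H0: "\<And>x. H (0, x) = x" and H1: "\<And>x. H (1, x) = a"
    unfolding homotopic_with_def by auto
  then have HW: "H ` ({0..1} \<times> W) \<subseteq> W"
    by blast
  obtain r where r: "r > 0" "(\<Union>x\<in>A. cball x r) \<subseteq> W"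
    using compact_subset_open_imp_cball_epsilon_subset[OF A(1) W(1) A(3)] .
  define K where "K = {x. infdist x A \<le> r}"
  have K: "compact K"
    unfolding K_def using compact_infdist_le[OF A(2,1) r(1)] .
  have inK: "x \<in> K" if "dist y x \<le> r" "y \<in> A" for x y
    using that infdist_le[of y A x] unfolding K_def by (simp add: dist_commute)
  have KW: "K \<subseteq> W"
  proof
    fix x assume "x \<in> K"
    moreover obtain y where "y \<in> A" "infdist x A = dist x y"
      using infdist_attains_inf[OF compact_imp_closed[OF A(1)] A(2)] by blast
    ultimately show "x \<in> W"
      using r(2) by (force simp: K_def dist_commute)
  qed
  define K' where "K' = H ` ({0..1} \<times> K)"
  have contK: "continuous_on ({0..1} \<times> K) H"
    using continuous_on_subset[OF contH] KW by (simp add: Sigma_mono)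
  have "compact K'"
    unfolding K'_def by (intro compact_continuous_image contK compact_Times K compact_Icc)
  moreover have "K' \<inter> B = {}"
    using HW KW B(2) unfolding K'_def by blast
  \<comment> \<open>Triangles will have diameter below \<open>3 * \<delta>\<close> and hence need the distance \<open>18 * \<delta>\<close>; moving
    points to general position and approximating \<open>B\<close> cost another \<open>\<delta>\<close> each.\<close>
  ultimately obtain \<delta> where \<delta>: "\<delta> > 0" and far: "\<And>x y. x \<in> K' \<Longrightarrow> y \<in> B \<Longrightarrow> 20 * \<delta> \<le> dist x y"
  proof -
    assume *: "\<And>\<delta>. 0 < \<delta> \<Longrightarrow> (\<And>x y. x \<in> K' \<Longrightarrow> y \<in> B \<Longrightarrow> 20 * \<delta> \<le> dist x y) \<Longrightarrow> thesis"
    obtain d where "d > 0" "\<forall>x\<in>K'. \<forall>y\<in>B. d \<le> dist x y"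
      using separate_compact_closed[OF \<open>compact K'\<close> compact_imp_closed[OF B(1)] \<open>K' \<inter> B = {}\<close>] by blast
    then show thesis
      by (intro *[of "d / 20"]) auto
  qed
  have "uniformly_continuous_on ({0..1} \<times> K) H"
    by (intro compact_uniformly_continuous contK compact_Times K compact_Icc)
  then obtain \<eta> where \<eta>: "\<eta> > 0"
    and unif: "\<And>p q. p \<in> {0..1} \<times> K \<Longrightarrow> q \<in> {0..1} \<times> K \<Longrightarrow> dist q p < \<eta> \<Longrightarrow> dist (H q) (H p) < \<delta>"
    unfolding uniformly_continuous_on_def using \<delta> by blast
  obtain m :: nat where m: "1 / of_nat (Suc m) < \<eta> / 2"
    by (rule nat_approx_posE[of "\<eta> / 2"]) (use \<eta> in auto)
  define n where "n = Suc m"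
  have n: "n > 0" "1 / n < \<eta> / 2"
    using m by (auto simp: n_def)
  define e where "e = min (r / 2) (min (\<eta> / 2) \<delta>)"
  have e: "e > 0" "e \<le> r / 2" "e \<le> \<eta> / 2" "e \<le> \<delta>"
    using r \<eta> \<delta> by (auto simp: e_def)
  have "lk c d = 0" if cl: "closed_chain c" "closed_chain d" and gen: "generic c d"
    and near: "fine_near e A c" "fine_near e B d" for c d
  proof -
    define ok where "ok x \<longleftrightarrow> (\<forall>y\<in>corners d. apart x y)" for x
    \<comment> \<open>Points in general position stay fixed, so that the trajectory of a corner of \<open>c\<close> starts there.\<close>
    define \<pi> where "\<pi> x = (if ok x then x else SOME x'. dist x x' < \<delta> \<and> ok x')" for x
    have \<pi>: "dist x (\<pi> x) < \<delta> \<and> ok (\<pi> x)" for x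
    proof (cases "ok x")
      case True
      then show ?thesis by (simp add: \<pi>_def \<delta>)
    next
      case False
      then show ?thesis
        using someI_ex[OF exists_apart_near[OF finite_corners[of d] \<delta>, of x]]
        by (simp add: \<pi>_def ok_def \<delta>)
    qed
    \<comment> \<open>The trajectory of \<open>x\<close> and the accumulated linking parity of its first \<open>j\<close> steps.\<close>
    define q where "q j x = \<pi> (H (real j / real n, x))" for j x
    define \<kappa> where "\<kappa> x y = lk [(x, y)] d" for x y
    define f where "f j x = (\<Sum>i<j. \<kappa> (q i x) (q (Suc i) x))" for j x

    have tri: "\<kappa> x y + \<kappa> y z + \<kappa> z x = 0"
      if "ok x" "ok y" "ok z" "dist x y < 3 * \<delta>" "dist x z < 3 * \<delta>" "w \<in> K'" "dist w x < \<delta>" for x y z w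
      unfolding \<kappa>_def
    proof (rule lk_triangle[OF cl(2), where e = "3 * \<delta>"])
      show "apart x' y'" if "x' \<in> {x, y, z}" "y' \<in> corners d" for x' y'
        using that \<open>ok x\<close> \<open>ok y\<close> \<open>ok z\<close> by (auto simp: ok_def)
      fix t assume t: "t \<in> set d"
      then obtain b where b: "b \<in> B" "dist b (fst t) < e" "dist (fst t) (snd t) < e"
        using near(2) unfolding fine_near_def by blast
      have "20 * \<delta> \<le> dist w b"
        using far[OF \<open>w \<in> K'\<close> b(1)] .
      also have "\<dots> \<le> dist w x + dist x (fst t) + dist b (fst t)"
        by metric
      finally show "6 * (3 * \<delta>) \<le> dist x (fst t) \<and> dist (fst t) (snd t) < 3 * \<delta>"
        using b e \<delta> \<open>dist w x < \<delta>\<close> by auto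
    qed (use that in auto)
    have step: "\<kappa> (q j x) (q j y) + \<kappa> (q (Suc j) x) (q (Suc j) y) =
        \<kappa> (q j x) (q (Suc j) x) + \<kappa> (q j y) (q (Suc j) y)"
      if "x \<in> K" "y \<in> K" "dist x y < e" "j < n" for x y j
    proof -
      have close: "dist (q i x') (q i' y') < 3 * \<delta>"
        if "i \<in> {j, Suc j}" "i' \<in> {j, Suc j}" "x' \<in> {x, y}" "y' \<in> {x, y}" for i i' x' y'
      proof -
        have "dist (real i / real n, x') (real i' / real n, y') \<le> dist (real i / real n) (real i' / real n) + dist x' y'"
          by (simp add: dist_Pair_Pair sqrt_sum_squares_le_sum)
        also have "dist (real i / real n) (real i' / real n) \<le> 1 / n"
          using that n by (auto simp: dist_real_def field_simps)
        also have "dist x' y' < e"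
          using that \<open>dist x y < e\<close> e(1) by (auto simp: dist_commute)
        finally have "dist (real i / real n, x') (real i' / real n, y') < \<eta>"
          using n e by linarith
        then have "dist (H (real i / real n, x')) (H (real i' / real n, y')) < \<delta>"
          using that \<open>x \<in> K\<close> \<open>y \<in> K\<close> \<open>j < n\<close> by (intro unif) auto
        moreover have "dist (H (real i / real n, x')) (q i x') < \<delta>" "dist (H (real i' / real n, y')) (q i' y') < \<delta>"
          unfolding q_def using \<pi> by auto
        moreover have "dist (q i x') (q i' y') \<le> dist (H (real i / real n, x')) (q i x') +
            dist (H (real i / real n, x')) (H (real i' / real n, y')) + dist (H (real i' / real n, y')) (q i' y')"
          by metric
        ultimately show ?thesis
          by linarith
      qed
      have inK': "H (real i / real n, x') \<in> K'" if "i \<in> {j, Suc j}" "x' \<in> {x, y}" for i x'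
        unfolding K'_def using that \<open>x \<in> K\<close> \<open>y \<in> K\<close> \<open>j < n\<close> by (intro imageI) auto
      have T: "\<kappa> (q i x') (q i' y') + \<kappa> (q i' y') (q i'' z') + \<kappa> (q i'' z') (q i x') = 0"
        if "i \<in> {j, Suc j}" "i' \<in> {j, Suc j}" "i'' \<in> {j, Suc j}" "x' \<in> {x, y}" "y' \<in> {x, y}" "z' \<in> {x, y}"
        for i i' i'' x' y' z'
        using that by (intro tri[where w = "H (real i / real n, x')"] close inK') (auto simp: q_def \<pi>)
      have refl: "\<kappa> z z = 0" for z
        by (simp add: \<kappa>_def lk_def overcrossing_def crossing_def)
      have sym: "\<kappa> (q i x') (q i' y') = \<kappa> (q i' y') (q i x')"
        if "i \<in> {j, Suc j}" "i' \<in> {j, Suc j}" "x' \<in> {x, y}" "y' \<in> {x, y}" for i i' x' y'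
        using T[OF that(1,2,1,3,4,3)] refl[of "q i x'"] by (simp add: bit_add_eq_0_iff)
      have "\<kappa> (q j x) (q j y) + \<kappa> (q j y) (q (Suc j) y) + \<kappa> (q (Suc j) y) (q j x) = 0"
        "\<kappa> (q j x) (q (Suc j) x) + \<kappa> (q (Suc j) x) (q (Suc j) y) + \<kappa> (q (Suc j) y) (q j x) = 0"
        by (rule T; simp)+
      then show ?thesis
        by (rule bit_two_triangles)
    qed
    have sweep: "\<kappa> (q 0 x) (q 0 y) = \<kappa> (q j x) (q j y) + (f j x + f j y)"
      if "x \<in> K" "y \<in> K" "dist x y < e" "j \<le> n" for x y j
      using that(4)
    proof (induction j)
      case 0
      then show ?case by (simp add: f_def)
    next
      case (Suc j)
      then have "\<kappa> (q (Suc j) x) (q (Suc j) y) =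
          \<kappa> (q j x) (q j y) + (\<kappa> (q j x) (q (Suc j) x) + \<kappa> (q j y) (q (Suc j) y))"
        using step[OF that(1-3), of j] by (metis Suc_le_eq bit_add_left_self)
      with Suc show ?case
        by (simp add: f_def algebra_simps)
    qed
    have "\<kappa> (fst s) (snd s) = f n (fst s) + f n (snd s)" if s: "s \<in> set c" for s
    proof -
      obtain y where y: "y \<in> A" "dist y (fst s) < e" "dist (fst s) (snd s) < e"
        using near(1) s unfolding fine_near_def by blast
      have "dist y (snd s) < 2 * e"
        using y dist_triangle[of y "snd s" "fst s"] by linarith
      then have "fst s \<in> K" "snd s \<in> K"
        using y e by (auto intro!: inK[of y])
      moreover have "ok (fst s)" "ok (snd s)"
        using gen s by (auto simp: ok_def generic_def corners_step)
      then have "q 0 (fst s) = fst s" "q 0 (snd s) = snd s"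
        by (simp_all add: q_def H0 \<pi>_def)
      moreover have "q n x = \<pi> a" for x
        using n by (simp add: q_def H1)
      then have "\<kappa> (q n (fst s)) (q n (snd s)) = 0"
        by (simp add: \<kappa>_def lk_def overcrossing_def crossing_def)
      ultimately show ?thesis
        using sweep[of "fst s" "snd s" n] y by simp
    qed
    then have "lk c d = boundary c (f n)"
      by (subst lk_eq_sum) (simp add: \<kappa>_def boundary_def cong: map_cong)
    then show "lk c d = 0"
      using cl(1) by (simp add: closed_chain_def)
  qed
  with e(1) show thesis
    using that by blast
qed

section \<open>Polygonal approximation in general position\<close>

text \<open>The points are moved one after the other, each of them avoiding the finitely many coordinates of
the previous ones.\<close>

lemma exists_apart_family:
  fixes x :: "'i \<Rightarrow> real ^ 3"
  assumes "finite I" "e > 0"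
  shows "\<exists>x'. (\<forall>i\<in>I. dist (x i) (x' i) < e) \<and> (\<forall>i\<in>I. \<forall>j\<in>I. i \<noteq> j \<longrightarrow> apart (x' i) (x' j))"
  using assms(1)
proof (induction I)
  case empty
  then show ?case by simp
next
  case (insert i I)
  from insert.IH obtain x' where
    "(\<forall>i\<in>I. dist (x i) (x' i) < e) \<and> (\<forall>i\<in>I. \<forall>j\<in>I. i \<noteq> j \<longrightarrow> apart (x' i) (x' j))" ..
  note x' = conjunct1[OF this] conjunct2[OF this]
  from exists_apart_near[OF finite_imageI[OF insert(1)] assms(2)]
  obtain y where "dist (x i) y < e \<and> (\<forall>z\<in>x' ` I. apart y z)" ..
  note y = conjunct1[OF this] conjunct2[OF this]
  have yI: "apart y (x' j)" "apart (x' j) y" if "j \<in> I" for j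
  proof -
    show "apart y (x' j)"
      using y(2) that by simp
    then show "apart (x' j) y"
      by (subst apart_sym)
  qed
  define x'' where "x'' = x'(i := y)"
  have x'': "x'' i = y" "\<And>j. j \<in> I \<Longrightarrow> x'' j = x' j"
    using insert(2) by (auto simp: x''_def)
  have "\<forall>j\<in>insert i I. dist (x j) (x'' j) < e"
    using x'(1) y(1) x'' by simp
  moreover have "apart (x'' j) (x'' k)" if "j \<in> insert i I" "k \<in> insert i I" "j \<noteq> k" for j k
    using that x'(2) yI x'' by (elim insertE) simp_all
  ultimately show ?case
    by blast
qed

lemma boundary_polygon: "boundary (map (\<lambda>i. (p i, p (Suc i))) [0..<n]) g = g (p 0) + g (p n)"
proof (induction n)
  case 0
  then show ?case by (simp add: boundary_def)
next
  case (Suc n)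
  then show ?case
    by (simp add: boundary_def add.assoc)
qed

lemma corners_polygon: "corners (map (\<lambda>i. (p i, p (Suc i))) [0..<n]) \<subseteq> p ` {..n}"
  by (auto simp: corners_def)

lemma path_subdivision:
  fixes g :: "real \<Rightarrow> 'a :: metric_space"
  assumes "path g" "e > 0"
  shows "\<exists>d>0. \<forall>s\<in>{0..1}. \<forall>t\<in>{0..1}. dist t s < d \<longrightarrow> dist (g t) (g s) < e"
proof -
  have "uniformly_continuous_on {0..1} g"
    using assms(1) unfolding path_def by (rule compact_uniformly_continuous) simp
  then show ?thesis
    using assms(2) unfolding uniformly_continuous_on_def by blast
qed

text \<open>Arcs with a common vertex have to share the point \<open>\<psi> v\<close> there, so that the chains of a cycle
fit together to a closed chain. All other points of the chains can be put in general position.\<close>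

proposition polygonal_approximation:
  fixes \<phi> :: "'v \<Rightarrow> real ^ 3" and \<gamma> :: "'v \<times> 'v \<Rightarrow> real \<Rightarrow> real ^ 3"
  assumes E: "finite E" and e: "e > 0"
    and \<gamma>: "\<And>a. a \<in> E \<Longrightarrow> path (\<gamma> a) \<and> pathstart (\<gamma> a) = \<phi> (fst a) \<and> pathfinish (\<gamma> a) = \<phi> (snd a)"
  obtains \<psi> ch where
    "\<And>a g. a \<in> E \<Longrightarrow> boundary (ch a) g = g (\<psi> (fst a)) + g (\<psi> (snd a))"
    "\<And>a. a \<in> E \<Longrightarrow> fine_near e (path_image (\<gamma> a)) (ch a)"
    "\<And>a b. a \<in> E \<Longrightarrow> b \<in> E \<Longrightarrow> {fst a, snd a} \<inter> {fst b, snd b} = {} \<Longrightarrow> generic (ch a) (ch b)"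
    "\<And>u v. u \<in> fst ` E \<union> snd ` E \<Longrightarrow> v \<in> fst ` E \<union> snd ` E \<Longrightarrow> u \<noteq> v \<Longrightarrow> apart (\<psi> u) (\<psi> v)"
proof -
  define modulus where "modulus a d \<longleftrightarrow> d > 0 \<and>
      (\<forall>s\<in>{0..1}. \<forall>t\<in>{0..1}. dist t s < d \<longrightarrow> dist (\<gamma> a t) (\<gamma> a s) < e / 3)" for a d
  have "\<forall>a\<in>E. \<exists>d. modulus a d"
    unfolding modulus_def using \<gamma> e by (intro ballI path_subdivision) auto
  from bchoice[OF this] obtain d where "\<forall>a\<in>E. modulus a (d a)" ..
  then have d: "\<And>a. a \<in> E \<Longrightarrow> d a > 0"
    "\<And>a s t. a \<in> E \<Longrightarrow> s \<in> {0..1} \<Longrightarrow> t \<in> {0..1} \<Longrightarrow> dist t s < d a \<Longrightarrow> dist (\<gamma> a t) (\<gamma> a s) < e / 3"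
    unfolding modulus_def by blast+
  obtain \<delta> :: real where \<delta>: "\<delta> > 0" "\<And>a. a \<in> E \<Longrightarrow> \<delta> \<le> d a"
  proof
    show "Min (insert 1 (d ` E)) > 0"
      using E d(1) by (subst Min_gr_iff) auto
    show "Min (insert 1 (d ` E)) \<le> d a" if "a \<in> E" for a
      using E that by (intro Min_le) auto
  qed
  obtain m :: nat where m: "1 / of_nat (Suc m) < \<delta>"
    by (rule nat_approx_posE[of \<delta>]) (use \<delta> in auto)
  define N where "N = Suc m"
  have N: "N > 0" "1 / N < \<delta>"
    using m by (auto simp: N_def)

  \<comment> \<open>Index the points of the chains so that arcs with a common vertex share exactly this point.\<close>
  define idx :: "'v \<times> 'v \<Rightarrow> nat \<Rightarrow> 'v + ('v \<times> 'v) \<times> nat" where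
    "idx a i = (if i = 0 then Inl (fst a) else if i = N then Inl (snd a) else Inr (a, i))" for a i
  define x :: "'v + ('v \<times> 'v) \<times> nat \<Rightarrow> real ^ 3" where
    "x j = (case j of Inl v \<Rightarrow> \<phi> v | Inr (a, i) \<Rightarrow> \<gamma> a (i / N))" for j
  define I where "I = Inl ` (fst ` E \<union> snd ` E) \<union> Inr ` (E \<times> {..N})"
  have "finite I"
    using E by (simp add: I_def)
  from exists_apart_family[OF this, of "e / 3" x] e
  obtain x' where "(\<forall>i\<in>I. dist (x i) (x' i) < e / 3) \<and> (\<forall>i\<in>I. \<forall>j\<in>I. i \<noteq> j \<longrightarrow> apart (x' i) (x' j))"
    by auto
  then have x': "\<And>i. i \<in> I \<Longrightarrow> dist (x i) (x' i) < e / 3"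
    "\<And>i j. i \<in> I \<Longrightarrow> j \<in> I \<Longrightarrow> i \<noteq> j \<Longrightarrow> apart (x' i) (x' j)"
    by blast+
  define p where "p a i = x' (idx a i)" for a i
  define ch where "ch a = map (\<lambda>i. (p a i, p a (Suc i))) [0..<N]" for a
  have idx: "idx a i \<in> I" if "a \<in> E" "i \<le> N" for a i
    using that by (auto simp: idx_def I_def)
  have near: "dist (\<gamma> a (i / N)) (p a i) < e / 3" if "a \<in> E" "i \<le> N" for a i
  proof -
    have "x (idx a i) = \<gamma> a (i / N)"
      using \<gamma>[OF that(1)] N(1) by (simp add: x_def idx_def pathstart_def pathfinish_def)
    with x'(1)[OF idx[OF that]] show ?thesis
      by (simp add: p_def)
  qed
  show thesis
  proof (rule that[of ch "\<lambda>v. x' (Inl v)"])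
    show "boundary (ch a) g = g (x' (Inl (fst a))) + g (x' (Inl (snd a)))" if "a \<in> E" for a g
      using N(1) unfolding ch_def boundary_polygon by (simp add: p_def idx_def)
    show "fine_near e (path_image (\<gamma> a)) (ch a)" if "a \<in> E" for a
      unfolding fine_near_def
    proof
      fix s assume "s \<in> set (ch a)"
      then obtain i where i: "i < N" "s = (p a i, p a (Suc i))"
        by (auto simp: ch_def)
      have "\<gamma> a (i / N) \<in> path_image (\<gamma> a)"
        using i by (auto simp: path_image_def)
      moreover have "dist (\<gamma> a (i / N)) (\<gamma> a (Suc i / N)) < e / 3"
      proof (rule d(2)[OF that])
        have "dist (real i / real N) (real (Suc i) / real N) = 1 / N"
          by (simp add: dist_real_def flip: diff_divide_distrib)
        then show "dist (real i / real N) (real (Suc i) / real N) < d a"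
          using N \<delta>(2)[OF that] by linarith
      qed (use i in auto)
      moreover note near[OF that, of i] near[OF that, of "Suc i"]
      moreover have "dist (p a i) (p a (Suc i)) \<le> dist (\<gamma> a (i / N)) (p a i) +
          dist (\<gamma> a (i / N)) (\<gamma> a (Suc i / N)) + dist (\<gamma> a (Suc i / N)) (p a (Suc i))"
        by metric
      ultimately show "(\<exists>x\<in>path_image (\<gamma> a). dist x (fst s) < e) \<and> dist (fst s) (snd s) < e"
        using i e by (intro conjI bexI[of _ "\<gamma> a (i / N)"]) auto
    qed
    show "generic (ch a) (ch b)" if "a \<in> E" "b \<in> E" "{fst a, snd a} \<inter> {fst b, snd b} = {}" for a b
    proof -
      have ne: "idx a i \<noteq> idx b j" for i j
        using that(3) by (auto simp: idx_def split: if_splits)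
      have "apart (p a i) (p b j)" if "i \<le> N" "j \<le> N" for i j
        unfolding p_def using ne idx \<open>a \<in> E\<close> \<open>b \<in> E\<close> that by (intro x'(2)) auto
      then show ?thesis
        using corners_polygon[of "p a" N] corners_polygon[of "p b" N]
        unfolding generic_def ch_def by blast
    qed
    show "apart (x' (Inl u)) (x' (Inl v))" if "u \<in> fst ` E \<union> snd ` E" "v \<in> fst ` E \<union> snd ` E" "u \<noteq> v" for u v
      using that by (intro x'(2)) (auto simp: I_def)
  qed
qed

section \<open>Split link_family in the 3-sphere\<close>

text \<open>Radial projection retracts the open half space onto the hemisphere.\<close>

lemma contractible_open_hemisphere:
  fixes a :: "'a::euclidean_space"
  shows "contractible {x \<in> sphere 0 1. 0 < a \<bullet> x}"
proof -
  let ?S = "{x. a \<bullet> x > 0}" and ?T = "{x \<in> sphere 0 1. 0 < a \<bullet> x}"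
  have nz: "norm x \<noteq> 0" if "x \<in> ?S" for x
    using that by auto
  have "retraction ?S ?T (\<lambda>x. x /\<^sub>R norm x)"
    unfolding retraction_def
  proof (intro conjI)
    show "continuous_on ?S (\<lambda>x. x /\<^sub>R norm x)"
      by (intro continuous_intros ballI nz)
    show "(\<lambda>x. x /\<^sub>R norm x) \<in> ?S \<rightarrow> ?T"
    proof
      fix x assume x: "x \<in> ?S"
      have "a \<bullet> (x /\<^sub>R norm x) = (a \<bullet> x) / norm x"
        by (simp add: divide_inverse_commute)
      moreover have "(a \<bullet> x) / norm x > 0"
        using x nz[OF x] by (intro divide_pos_pos) auto
      moreover have "norm (x /\<^sub>R norm x) = 1"
        using nz[OF x] by simp
      ultimately show "x /\<^sub>R norm x \<in> ?T"
        by simp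
    qed
  qed auto
  then have "?T retract_of ?S"
    unfolding retract_of_def by (rule exI[where x = "\<lambda>x. x /\<^sub>R norm x"])
  with convex_imp_contractible[OF convex_halfspace_gt] show ?thesis
    by (rule retract_of_contractible)
qed

text \<open>The complement of a tame 2-sphere consists of the images of two open hemispheres. They are
contractible, and at least one of them misses \<open>p\<close>; which of the two cycles it contains cannot be
prescribed.\<close>

lemma split_link_contractible:
  assumes "split_link A B" and A: "A \<noteq> {}" "A \<subseteq> S3 - {p}" and B: "B \<noteq> {}" "B \<subseteq> S3 - {p}"
    and h: "homeomorphism (S3 - {p}) (UNIV :: (real ^ 3) set) h k"
  obtains W where "open W" "contractible W"
    "h ` A \<subseteq> W \<and> W \<inter> h ` B = {} \<or> h ` B \<subseteq> W \<and> W \<inter> h ` A = {}"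
proof -
  from assms(1)[unfolded split_link_def] obtain \<Sigma> where
    "tame_2sphere \<Sigma> \<and> A \<subseteq> S3 - \<Sigma> \<and> B \<subseteq> S3 - \<Sigma> \<and>
      (\<forall>a \<in> A. \<forall>b \<in> B. \<not> connected_component (S3 - \<Sigma>) a b)" ..
  then have tame: "tame_2sphere \<Sigma>" and AB: "A \<subseteq> S3 - \<Sigma>" "B \<subseteq> S3 - \<Sigma>"
    and sep: "\<And>a b. a \<in> A \<Longrightarrow> b \<in> B \<Longrightarrow> \<not> connected_component (S3 - \<Sigma>) a b"
    by simp_all
  from tame[unfolded tame_2sphere_def] obtain f g where
    "homeomorphism S3 S3 f g \<and> \<Sigma> = f ` {x \<in> S3. x $ 4 = 0}"
    by (elim exE)
  then have f: "homeomorphism S3 S3 f g" and \<Sigma>: "\<Sigma> = f ` {x \<in> S3. x $ 4 = 0}"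
    by simp_all
  define H where "H \<sigma> = {x \<in> S3. 0 < axis 4 \<sigma> \<bullet> x}" for \<sigma> :: real
  define V where "V \<sigma> = f ` H \<sigma>" for \<sigma>
  have HS: "H \<sigma> \<subseteq> S3" for \<sigma>
    by (auto simp: H_def)
  have inj: "inj_on f S3"
    by (rule inj_on_inverseI[of _ g]) (rule homeomorphism_apply1[OF f])
  have fS: "f ` S3 = S3"
    using f by (simp add: homeomorphism_def)
  have VS: "V \<sigma> \<subseteq> S3" for \<sigma>
    using image_mono[OF HS[of \<sigma>], of f] unfolding V_def fS .
  have H4: "x \<in> H 1 \<longleftrightarrow> x \<in> S3 \<and> 0 < x $ 4" "x \<in> H (-1) \<longleftrightarrow> x \<in> S3 \<and> x $ 4 < 0" for x
    by (auto simp: H_def inner_axis')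
  have contr: "contractible (H \<sigma>)" for \<sigma>
    unfolding H_def by (rule contractible_open_hemisphere)
  have "openin (top_of_set S3) (S3 \<inter> {x. axis 4 \<sigma> \<bullet> x > 0})" for \<sigma>
    by (intro openin_open_Int open_halfspace_gt)
  then have "openin (top_of_set S3) (H \<sigma>)" for \<sigma>
    by (simp add: H_def Int_def)
  then have openV: "openin (top_of_set S3) (V \<sigma>)" for \<sigma>
    unfolding V_def using homeomorphism_imp_open_map[OF f] by blast
  have "homeomorphism (H \<sigma>) (V \<sigma>) f g" for \<sigma>
    using homeomorphism_of_subsets[OF f HS subset_refl] unfolding V_def by blast
  then have "H \<sigma> homeomorphic V \<sigma>" for \<sigma>
    unfolding homeomorphic_def by blast
  then have contrV: "contractible (V \<sigma>)" for \<sigma>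
    using homeomorphic_contractible_eq contr by blast
  have connV: "connected (V \<sigma>)" for \<sigma>
    by (rule contractible_imp_connected[OF contrV])
  have avoid: "V \<sigma> \<subseteq> S3 - \<Sigma>" if "\<sigma> \<in> {1, -1}" for \<sigma>
    using that VS[of \<sigma>] inj unfolding V_def \<Sigma> by (auto simp: H4 dest: inj_onD)
  have cover: "S3 - \<Sigma> = V 1 \<union> V (-1)"
  proof
    show "S3 - \<Sigma> \<subseteq> V 1 \<union> V (-1)"
    proof
      fix y assume y: "y \<in> S3 - \<Sigma>"
      then obtain x where "x \<in> S3" "y = f x" "x $ 4 \<noteq> 0"
        using fS unfolding \<Sigma> by blast
      then show "y \<in> V 1 \<union> V (-1)"
        unfolding V_def using H4[of x] by (meson UnCI imageI linorder_neqE_linordered_idom)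
    qed
  qed (use avoid in auto)
  have disj: "V 1 \<inter> V (-1) = {}"
    using inj unfolding V_def by (fastforce simp: H4 dest: inj_onD)
  have side: "Y \<subseteq> V (-\<sigma>)"
    if "\<sigma> \<in> {1, -1}" "x \<in> X" "x \<in> V \<sigma>" "Y \<subseteq> V 1 \<union> V (-1)"
      "\<And>y. y \<in> Y \<Longrightarrow> \<not> connected_component (V 1 \<union> V (-1)) x y" for \<sigma> x X Y
  proof
    fix y assume "y \<in> Y"
    moreover have "y \<notin> V \<sigma>"
      using that(5)[OF \<open>y \<in> Y\<close>] connected_componentI[OF connV, of \<sigma> "V 1 \<union> V (-1)" x y] that(1,3) by auto
    ultimately show "y \<in> V (-\<sigma>)"
      using that(1,4) by auto
  qed
  have "\<exists>\<sigma>\<in>{1, -1}. A \<subseteq> V \<sigma> \<and> B \<subseteq> V (-\<sigma>)"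
  proof -
    obtain a b where ab: "a \<in> A" "b \<in> B"
      using A B by blast
    then obtain \<sigma> where \<sigma>: "\<sigma> \<in> {1, -1}" "a \<in> V \<sigma>"
      using AB cover by blast
    have "B \<subseteq> V (-\<sigma>)"
      using side[OF \<sigma>(1) ab(1) \<sigma>(2), of B] AB(2) sep[OF ab(1)] unfolding cover by blast
    moreover have "A \<subseteq> V (- (-\<sigma>))"
    proof (rule side[of "-\<sigma>" b B])
      show "\<not> connected_component (V 1 \<union> V (- 1)) b y" if "y \<in> A" for y
        using sep[OF that ab(2)] unfolding cover by (meson connected_component_sym)
    qed (use \<sigma> ab AB cover calculation in auto)
    ultimately show ?thesis
      using \<sigma> by auto
  qed
  then obtain \<sigma> where \<sigma>: "\<sigma> \<in> {1, -1}" "A \<subseteq> V \<sigma>" "B \<subseteq> V (-\<sigma>)"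
    by blast
  have disj': "V \<sigma> \<inter> V (-\<sigma>) = {}"
    using disj \<sigma>(1) by auto
  have W: "open (h ` V \<tau>) \<and> contractible (h ` V \<tau>)" if "p \<notin> V \<tau>" for \<tau>
  proof
    have sub: "V \<tau> \<subseteq> S3 - {p}"
      using that VS by blast
    then have "openin (top_of_set (S3 - {p})) (V \<tau>)"
      using openin_subset_trans[OF openV] by blast
    from homeomorphism_imp_open_map[OF h this] show "open (h ` V \<tau>)"
      by simp
    have "homeomorphism (V \<tau>) (h ` V \<tau>) h k"
      using homeomorphism_of_subsets[OF h sub, of "h ` V \<tau>"] by simp
    then have "V \<tau> homeomorphic h ` V \<tau>"
      unfolding homeomorphic_def by blast
    then show "contractible (h ` V \<tau>)"
      using homeomorphic_contractible_eq contrV by blast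
  qed
  have disjW: "h ` X \<inter> h ` Y = {}" if "X \<inter> Y = {}" "X \<subseteq> S3 - {p}" "Y \<subseteq> S3 - {p}" for X Y
  proof -
    have "inj_on h (S3 - {p})"
      by (rule inj_on_inverseI[of _ k]) (rule homeomorphism_apply1[OF h])
    then show ?thesis
      using that by (metis inj_on_image_Int image_empty)
  qed
  show thesis
  proof (cases "p \<in> V \<sigma>")
    case False
    then show thesis
      using W[of \<sigma>] disjW[of "V \<sigma>" B] \<sigma> disj' B VS[of \<sigma>]
      by (intro that[of "h ` V \<sigma>"]) blast+
  next
    case True
    then have "p \<notin> V (-\<sigma>)"
      using disj' by blast
    then show thesis
      using W[of "-\<sigma>"] disjW[of "V (-\<sigma>)" A] \<sigma> disj' A VS[of "-\<sigma>"]
      by (intro that[of "h ` V (-\<sigma>)"]) blast+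
  qed
qed

section \<open>The linking parities of an embedded digraph\<close>

text \<open>The evaluation of a function on the boundary of an arc.\<close>

definition endsum :: "'v \<times> 'v \<Rightarrow> ('v \<Rightarrow> bit) \<Rightarrow> bit" where
  "endsum e g = g (fst e) + g (snd e)"

text \<open>For arcs without common vertex this is 1 exactly if the two pairs of ends separate each other in the
linear order, that is, if the arcs cross as chords of a convex polygon.\<close>

definition interleave :: "'v :: linorder \<times> 'v \<Rightarrow> 'v \<times> 'v \<Rightarrow> bit" where
  "interleave e f = endsum e (\<lambda>a. endsum f (\<lambda>b. of_bool (a < b)))"

lemma endsum_add: "endsum e (\<lambda>a. g a + h a) = endsum e g + endsum e h"
  by (simp add: endsum_def algebra_simps)

lemma endsum_swap: "endsum e (\<lambda>a. endsum f (\<lambda>b. g a b)) = endsum f (\<lambda>b. endsum e (\<lambda>a. g a b))"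
  by (simp add: endsum_def algebra_simps)

lemma endsum_cong: "(\<And>a. a \<in> {fst e, snd e} \<Longrightarrow> g a = h a) \<Longrightarrow> endsum e g = endsum e h"
  by (simp add: endsum_def)

lemma (in pre_digraph) cas_heads_tails: "cas u p v \<Longrightarrow> insert v (tail G ` set p) = insert u (head G ` set p)"
proof (induction p arbitrary: u)
  case Nil
  then show ?case by simp
next
  case (Cons e p)
  then have "insert v (tail G ` set p) = insert (head G e) (head G ` set p)"
    by simp
  then show ?case
    using Cons.prems by (simp add: insert_commute)
qed

lemma (in pre_digraph) cycle_heads_eq_tails:
  assumes "cycle c"
  shows "head G ` set c = tail G ` set c"
proof -
  obtain u where u: "cas u c u" "c \<noteq> []"
    using assms unfolding cycle_def awalk_def by blast
  obtain e c' where c: "c = e # c'"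
    using u(2) by (cases c) auto
  have "u = tail G e"
    using u(1) c by simp
  then have t: "u \<in> tail G ` set c"
    using c by simp
  have "cas w p u \<Longrightarrow> p \<noteq> [] \<Longrightarrow> u \<in> head G ` set p" for w p
  proof (induction p arbitrary: w)
    case Nil
    then show ?case by simp
  next
    case (Cons a p)
    then show ?case by (cases p) auto
  qed
  then have "u \<in> head G ` set c"
    using u by blast
  with t cas_heads_tails[OF u(1)] show ?thesis
    by (simp add: insert_absorb)
qed

lemma cycle_endsum:
  fixes G :: "('v, 'v \<times> 'v) pre_digraph"
  assumes "pre_digraph.cycle G c" "tail G = fst" "head G = snd"
  shows "(\<Sum>e\<leftarrow>c. endsum e g) = 0"
proof -
  obtain u where "pre_digraph.cas G u c u"
    using assms(1) unfolding pre_digraph.cycle_def pre_digraph.awalk_def by blast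
  moreover have "(\<Sum>e\<leftarrow>p. endsum e g) = g u + g v" if "pre_digraph.cas G u p v" for u p v
    using that
  proof (induction p arbitrary: u)
    case Nil
    then show ?case by (simp add: pre_digraph.cas.simps)
  next
    case (Cons e p)
    then show ?case
      by (auto simp: pre_digraph.cas.simps assms(2,3) endsum_def ac_simps)
  qed
  ultimately show ?thesis by simp
qed

lemma boundary_concat: "boundary (concat cs) g = (\<Sum>c\<leftarrow>cs. boundary c g)"
  by (induction cs) (simp_all add: boundary_def)

lemma lk_append_left: "lk (c @ c') d = lk c d + lk c' d"
  by (simp add: lk_def)

lemma lk_append_right: "lk c (d @ d') = lk c d + lk c d'"
  by (simp add: lk_def sum_list_addf)

lemma lk_concat: "lk (concat cs) (concat ds) = (\<Sum>c\<leftarrow>cs. \<Sum>d\<leftarrow>ds. lk c d)"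
proof (induction cs)
  case Nil
  then show ?case by (simp add: lk_def)
next
  case (Cons c cs)
  have "lk c (concat ds) = (\<Sum>d\<leftarrow>ds. lk c d)"
    by (induction ds) (simp_all add: lk_append_right, simp add: lk_def)
  with Cons show ?case
    by (simp add: lk_append_left)
qed

lemma corners_concat: "corners (concat cs) = (\<Union>c\<in>set cs. corners c)"
  by (auto simp: corners_def)

text \<open>The function \<open>Z\<close> is the overcrossing parity of the chains of two arcs, corrected by terms \<open>R\<close>. These
vanish in the sum over a cycle in the second argument because they are boundary terms, and they turn
the crossing parity of two arcs into a quantity that is the same for all embeddings.\<close>

proposition overcrossing_parities_of_split_links:
  fixes G :: "('v :: linorder, 'v \<times> 'v) pre_digraph"
  assumes G: "digraph G" "tail G = fst" "head G = snd"
    and emb: "tame_embedding G \<phi> \<gamma>"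
    and S: "finite S" "\<And>c d. (c, d) \<in> S \<Longrightarrow> consistent_link G c d"
    and split: "\<And>c d. (c, d) \<in> S \<Longrightarrow> split_link (embedded_cycle \<gamma> c) (embedded_cycle \<gamma> d)"
  obtains Z :: "'v \<times> 'v \<Rightarrow> 'v \<times> 'v \<Rightarrow> bit" where
    "\<And>e f. e \<in> arcs G \<Longrightarrow> f \<in> arcs G \<Longrightarrow> {fst e, snd e} \<inter> {fst f, snd f} = {} \<Longrightarrow>
       Z e f + Z f e = interleave e f"
    "\<And>c d. (c, d) \<in> S \<Longrightarrow> (\<Sum>e\<leftarrow>c. \<Sum>f\<leftarrow>d. Z e f) = 0"
proof -
  have finE: "finite (arcs G)"
    using G(1) by (simp add: digraph_def fin_digraph.finite_arcs)
  have spat: "spatial_embedding G \<phi> \<gamma>" and tame: "tame_1dim (\<phi> ` verts G \<union> (\<Union>e \<in> arcs G. path_image (\<gamma> e)))"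
    using emb by (simp_all add: tame_embedding_def)
  from tame[unfolded tame_1dim_def] obtain p h k where
    X: "\<phi> ` verts G \<union> (\<Union>e \<in> arcs G. path_image (\<gamma> e)) \<subseteq> S3 - {p}" and
    h: "homeomorphism (S3 - {p}) (UNIV :: (real ^ 3) set) h k"
    by (elim exE conjE)
  have arcI: "path (\<gamma> e)" "path_image (\<gamma> e) \<subseteq> S3 - {p}"
      "pathstart (\<gamma> e) = \<phi> (fst e)" "pathfinish (\<gamma> e) = \<phi> (snd e)"
    if "e \<in> arcs G" for e
    using spat X that unfolding spatial_embedding_def G(2,3) by (auto intro: simple_path_imp_path)
  define g where "g e = h \<circ> \<gamma> e" for e
  have conth: "continuous_on (S3 - {p}) h"
    using h by (simp add: homeomorphism_def)
  have g: "path (g e) \<and> pathstart (g e) = h (\<phi> (fst e)) \<and> pathfinish (g e) = h (\<phi> (snd e))"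
    if "e \<in> arcs G" for e
    unfolding g_def using arcI[OF that] continuous_on_subset[OF conth]
    by (simp add: path_continuous_image pathstart_compose pathfinish_compose)

  define img where "img c = (\<Union>e\<in>set c. path_image (g e))" for c
  have img: "img c = h ` embedded_cycle \<gamma> c" for c
    by (simp add: img_def g_def path_image_compose embedded_cycle_def image_UN)
  have cyc: "set c \<subseteq> arcs G" "c \<noteq> []" if "pre_digraph.cycle G c" for c
    using that by (auto simp: pre_digraph.cycle_def pre_digraph.awalk_def)
  have img_props: "compact (img c)" "img c \<noteq> {}" if "pre_digraph.cycle G c" for c
  proof -
    show "compact (img c)"
      unfolding img_def using cyc(1)[OF that] g by (intro compact_UN compact_path_image) auto
    show "img c \<noteq> {}"
      using cyc(2)[OF that] by (cases c) (auto simp: img_def)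
  qed

  define good where "good c d e \<longleftrightarrow> e > 0 \<and> (\<forall>c' d'. closed_chain c' \<longrightarrow> closed_chain d' \<longrightarrow> generic c' d' \<longrightarrow>
      fine_near e (img c) c' \<longrightarrow> fine_near e (img d) d' \<longrightarrow> lk c' d' = 0)" for c d e
  have "\<exists>e. good c d e" if cd: "(c, d) \<in> S" for c d
  proof -
    have cyc': "pre_digraph.cycle G c" "pre_digraph.cycle G d"
      using S(2)[OF cd] by (auto simp: consistent_link_def)
    have sub: "embedded_cycle \<gamma> x \<subseteq> S3 - {p}" if "pre_digraph.cycle G x" for x
      using cyc(1)[OF that] arcI(2) by (auto simp: embedded_cycle_def)
    have ne: "embedded_cycle \<gamma> x \<noteq> {}" if "pre_digraph.cycle G x" for x
      using img_props(2)[OF that] img[of x] by auto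
    obtain W where W: "open W" "contractible W"
      "img c \<subseteq> W \<and> W \<inter> img d = {} \<or> img d \<subseteq> W \<and> W \<inter> img c = {}"
      using split_link_contractible[OF split[OF cd] ne[OF cyc'(1)] sub[OF cyc'(1)] ne[OF cyc'(2)] sub[OF cyc'(2)] h]
      unfolding img by metis
    show ?thesis
    proof (cases "img c \<subseteq> W \<and> W \<inter> img d = {}")
      case True
      obtain e where "e > 0" "\<And>c' d'. closed_chain c' \<Longrightarrow> closed_chain d' \<Longrightarrow> generic c' d' \<Longrightarrow>
         fine_near e (img c) c' \<Longrightarrow> fine_near e (img d) d' \<Longrightarrow> lk c' d' = 0"
        using lk_contractible[OF W(1,2) img_props[OF cyc'(1)] _ img_props(1)[OF cyc'(2)]] True by metis
      then show ?thesis
        unfolding good_def by blast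
    next
      \<comment> \<open>The ball contains the second cycle; the linking parity is symmetric for closed chains.\<close>
      case False
      then have F: "img d \<subseteq> W" "W \<inter> img c = {}"
        using W(3) by auto
      obtain e where e: "e > 0" "\<And>d' c'. closed_chain d' \<Longrightarrow> closed_chain c' \<Longrightarrow> generic d' c' \<Longrightarrow>
         fine_near e (img d) d' \<Longrightarrow> fine_near e (img c) c' \<Longrightarrow> lk d' c' = 0"
        using lk_contractible[OF W(1,2) img_props[OF cyc'(2)] F(1) img_props(1)[OF cyc'(1)] F(2)] by metis
      have "lk c' d' = 0" if "closed_chain c'" "closed_chain d'" "generic c' d'"
          "fine_near e (img c) c'" "fine_near e (img d) d'" for c' d'
        using e(2)[of d' c'] lk_commute[of c' d'] generic_sym that by metis
      with e(1) show ?thesis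
        unfolding good_def by blast
    qed
  qed
  then have "\<forall>x\<in>S. \<exists>e. good (fst x) (snd x) e"
    by auto
  from bchoice[OF this] obtain \<epsilon> where \<epsilon>: "\<forall>x\<in>S. good (fst x) (snd x) (\<epsilon> x)" ..
  define e where "e = Min (insert 1 (\<epsilon> ` S))"
  have e: "e > 0"
    unfolding e_def using S(1) \<epsilon> by (subst Min_gr_iff) (auto simp: good_def)
  have e_le: "e \<le> \<epsilon> x" if "x \<in> S" for x
    unfolding e_def using that S(1) by (intro Min_le) auto

  show thesis
  proof (rule polygonal_approximation[where \<phi> = "\<lambda>v. h (\<phi> v)" and \<gamma> = g, OF finE e g])
    fix \<psi> ch
    assume bd: "\<And>a g. a \<in> arcs G \<Longrightarrow> boundary (ch a) g = g (\<psi> (fst a)) + g (\<psi> (snd a))"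
      and near: "\<And>a. a \<in> arcs G \<Longrightarrow> fine_near e (path_image (g a)) (ch a)"
      and gen: "\<And>a b. a \<in> arcs G \<Longrightarrow> b \<in> arcs G \<Longrightarrow> {fst a, snd a} \<inter> {fst b, snd b} = {} \<Longrightarrow> generic (ch a) (ch b)"
      and apart: "\<And>u v. u \<in> fst ` arcs G \<union> snd ` arcs G \<Longrightarrow> v \<in> fst ` arcs G \<union> snd ` arcs G \<Longrightarrow> u \<noteq> v \<Longrightarrow> apart (\<psi> u) (\<psi> v)"
    \<comment> \<open>\<open>D x y + D y x\<close> records whether the order of the second coordinates of \<open>\<psi> x\<close> and
      \<open>\<psi> y\<close> disagrees with the order of the vertices.\<close>
    define D where "D a b = of_bool (a < b) * (lt (\<psi> a $ 2) (\<psi> b $ 2) + 1)" for a b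
    define R where "R a f = endsum f (\<lambda>b. rays (ch a) (\<psi> b) + endsum a (\<lambda>x. D x b))" for a f
    define Z where "Z a b = lk (ch a) (ch b) + R a b" for a b
    have bd': "boundary (ch a) g = endsum a (\<lambda>v. g (\<psi> v))" if "a \<in> arcs G" for a g
      using bd[OF that] by (simp add: endsum_def)
    have vert: "x \<in> fst ` arcs G \<union> snd ` arcs G" if "a \<in> arcs G" "x \<in> {fst a, snd a}" for a x
      using that by auto
    have Dsym: "D x y + D y x = lt (\<psi> x $ 2) (\<psi> y $ 2) + of_bool (x < y)"
      if "x \<in> fst ` arcs G \<union> snd ` arcs G" "y \<in> fst ` arcs G \<union> snd ` arcs G" "x \<noteq> y" for x y
    proof -
      have "\<psi> x $ 2 \<noteq> \<psi> y $ 2"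
        using apart[OF that] by (simp add: apart_def)
      then have "lt (\<psi> y $ 2) (\<psi> x $ 2) = 1 + lt (\<psi> x $ 2) (\<psi> y $ 2)"
        by (rule lt_swap)
      with that(3) show ?thesis
        by (cases "x < y") (auto simp: D_def algebra_simps)
    qed
    show thesis
    proof (rule that[of Z])
      fix a b assume ab: "a \<in> arcs G" "b \<in> arcs G" "{fst a, snd a} \<inter> {fst b, snd b} = {}"
      let ?p = "endsum b (\<lambda>y. rays (ch a) (\<psi> y))" and ?q = "endsum a (\<lambda>x. rays (ch b) (\<psi> x))"
        and ?t = "endsum a (\<lambda>x. endsum b (\<lambda>y. lt (\<psi> x $ 2) (\<psi> y $ 2)))"
      have L: "lk (ch a) (ch b) + lk (ch b) (ch a) = ?p + ?q + ?t"
        using lk_swap_sum[OF gen[OF ab]] by (simp add: bd' ab)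
      have "R a b + R b a = ?p + ?q + endsum a (\<lambda>x. endsum b (\<lambda>y. D x y + D y x))"
        unfolding R_def endsum_add by (subst endsum_swap[of b a]) (simp add: algebra_simps)
      also have "endsum a (\<lambda>x. endsum b (\<lambda>y. D x y + D y x)) =
         endsum a (\<lambda>x. endsum b (\<lambda>y. lt (\<psi> x $ 2) (\<psi> y $ 2) + of_bool (x < y)))"
        using ab(3) by (intro endsum_cong Dsym vert[OF ab(1)] vert[OF ab(2)]) auto
      also have "\<dots> = ?t + interleave a b"
        by (simp add: interleave_def endsum_add)
      finally have R: "R a b + R b a = ?p + ?q + (?t + interleave a b)" .
      have "Z a b + Z b a = (lk (ch a) (ch b) + lk (ch b) (ch a)) + (R a b + R b a)"
        by (simp add: Z_def ac_simps)
      also have "\<dots> = (?p + ?q + ?t) + (?p + ?q + (?t + interleave a b))"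
        by (simp only: L R)
      also have "\<dots> = interleave a b"
        by (simp add: ac_simps)
      finally show "Z a b + Z b a = interleave a b" .
    next
      fix c d assume cd: "(c, d) \<in> S"
      have cyc': "pre_digraph.cycle G c" "pre_digraph.cycle G d" and dj: "fst ` set c \<inter> fst ` set d = {}"
        using S(2)[OF cd] by (auto simp: consistent_link_def G)
      have heads: "snd ` set c = fst ` set c" "snd ` set d = fst ` set d"
        using pre_digraph.cycle_heads_eq_tails[OF cyc'(1)] pre_digraph.cycle_heads_eq_tails[OF cyc'(2)] by (simp_all add: G)
      note sub = cyc(1)[OF cyc'(1)] cyc(1)[OF cyc'(2)]
      have closed: "closed_chain (concat (map ch x))" if "pre_digraph.cycle G x" for x
        unfolding closed_chain_def
      proof
        fix g
        have "boundary (concat (map ch x)) g = (\<Sum>a\<leftarrow>x. boundary (ch a) g)"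
          by (simp add: boundary_concat o_def)
        also have "\<dots> = (\<Sum>a\<leftarrow>x. endsum a (\<lambda>v. g (\<psi> v)))"
          using cyc(1)[OF that] by (intro arg_cong[of _ _ sum_list] map_cong refl bd') auto
        also have "\<dots> = 0"
          by (rule cycle_endsum[OF that G(2,3)])
        finally show "boundary (concat (map ch x)) g = 0" .
      qed
      have nearc: "fine_near (\<epsilon> (c, d)) (img x) (concat (map ch x))" if "set x \<subseteq> arcs G" for x
        unfolding fine_near_def
      proof
        fix s assume "s \<in> set (concat (map ch x))"
        then obtain a where a: "a \<in> set x" "s \<in> set (ch a)"
          by auto
        with near[of a] that have "(\<exists>z\<in>path_image (g a). dist z (fst s) < e) \<and> dist (fst s) (snd s) < e"
          by (auto simp: fine_near_def)
        then show "(\<exists>z\<in>img x. dist z (fst s) < \<epsilon> (c, d)) \<and> dist (fst s) (snd s) < \<epsilon> (c, d)"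
          using e_le[OF cd] a(1) unfolding img_def by force
      qed
      have "generic (concat (map ch c)) (concat (map ch d))"
      proof -
        have "generic (ch a) (ch b)" if "a \<in> set c" "b \<in> set d" for a b
        proof (rule gen)
          have "{fst a, snd a} \<subseteq> fst ` set c" "{fst b, snd b} \<subseteq> fst ` set d"
            using that heads by (auto simp: set_eq_iff)
          then show "{fst a, snd a} \<inter> {fst b, snd b} = {}"
            using dj by blast
        qed (use sub that in auto)
        then show ?thesis
          by (auto simp: generic_def corners_concat)
      qed
      then have "lk (concat (map ch c)) (concat (map ch d)) = 0"
        using \<epsilon> cd closed[OF cyc'(1)] closed[OF cyc'(2)] nearc[OF sub(1)] nearc[OF sub(2)]
        unfolding good_def by force
      then have "(\<Sum>a\<leftarrow>c. \<Sum>b\<leftarrow>d. lk (ch a) (ch b)) = 0"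
        by (simp add: lk_concat o_def)
      moreover have "(\<Sum>b\<leftarrow>d. R a b) = 0" for a
        unfolding R_def by (rule cycle_endsum[OF cyc'(2) G(2,3)])
      ultimately show "(\<Sum>a\<leftarrow>c. \<Sum>b\<leftarrow>d. Z a b) = 0"
        by (simp add: Z_def sum_list_addf)
    qed
  qed
qed

section \<open>Digraphs given by lists of arcs\<close>

definition arc_digraph :: "nat \<Rightarrow> (nat \<times> nat) list \<Rightarrow> (nat, nat \<times> nat) pre_digraph" where
  "arc_digraph n es = \<lparr>verts = {0..<n}, arcs = set es, tail = fst, head = snd\<rparr>"

lemma arc_digraph_simps [simp]:
  "verts (arc_digraph n es) = {0..<n}" "arcs (arc_digraph n es) = set es"
  "tail (arc_digraph n es) = fst" "head (arc_digraph n es) = snd"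
  by (simp_all add: arc_digraph_def)

text \<open>A formulation for lists that can be decided by evaluation.\<close>

definition is_tournament :: "nat \<Rightarrow> (nat \<times> nat) list \<Rightarrow> bool" where
  "is_tournament n es \<longleftrightarrow> distinct es \<and> (\<forall>e\<in>set es. fst e < n \<and> snd e < n \<and> fst e \<noteq> snd e) \<and>
     (\<forall>u\<in>set [0..<n]. \<forall>v\<in>set [0..<n]. u \<noteq> v \<longrightarrow>
        ((u, v) \<in> set es \<or> (v, u) \<in> set es) \<and> \<not> ((u, v) \<in> set es \<and> (v, u) \<in> set es))"

lemma digraph_arc_digraph:
  assumes "is_tournament n es"
  shows "digraph (arc_digraph n es)"
  using assms by unfold_locales (auto simp: is_tournament_def arc_to_ends_def prod_eq_iff)

lemma tournament_arc_digraph: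
  assumes "is_tournament n es"
  shows "tournament (arc_digraph n es)"
proof -
  have "\<exists>!e. e \<in> set es \<and> (fst e = u \<and> snd e = v \<or> fst e = v \<and> snd e = u)"
    if "u < n" "v < n" "u \<noteq> v" for u v
  proof -
    have "((u, v) \<in> set es \<or> (v, u) \<in> set es) \<and> \<not> ((u, v) \<in> set es \<and> (v, u) \<in> set es)"
      using assms that unfolding is_tournament_def set_upt by (meson atLeastLessThan_iff zero_le)
    then show ?thesis
      by (metis prod.collapse fst_conv snd_conv)
  qed
  with digraph_arc_digraph[OF assms] show ?thesis
    by (simp add: tournament_def)
qed

lemma score_sequence_arc_digraph:
  assumes "distinct es"
  shows "score_sequence (arc_digraph n es) = sort (map (\<lambda>v. length (filter (\<lambda>e. fst e = v) es)) [0..<n])"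
proof -
  have "out_degree (arc_digraph n es) v = length (filter (\<lambda>e. fst e = v) es)" for v
    using distinct_card[OF distinct_filter[OF assms], of "\<lambda>e. fst e = v"]
    by (simp add: out_degree_def out_arcs_def)
  then have "out_degree (arc_digraph n es) = (\<lambda>v. length (filter (\<lambda>e. fst e = v) es))" ..
  then have "image_mset (out_degree (arc_digraph n es)) (mset_set {0..<n}) =
      mset (map (\<lambda>v. length (filter (\<lambda>e. fst e = v) es)) [0..<n])"
    by (simp add: mset_set_upto_eq_mset_upto)
  then show ?thesis
    by (simp add: score_sequence_def del: mset_map)
qed

definition circuit :: "'v list \<Rightarrow> ('v \<times> 'v) list" where
  "circuit vs = zip vs (rotate1 vs)"

lemma fst_circuit: "fst ` set (circuit vs) = set vs"
proof -
  have "map fst (circuit vs) = vs"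
    by (simp add: circuit_def)
  then show ?thesis
    by (metis list.set_map)
qed

text \<open>Directed cycles can thus be written as lists of vertices, the form in which disjointness is apparent.\<close>

lemma cycle_circuit:
  assumes "set (circuit vs) \<subseteq> set es" "distinct vs" "vs \<noteq> []" "\<forall>e\<in>set es. fst e < n"
  shows "pre_digraph.cycle (arc_digraph n es) (circuit vs)"
proof -
  let ?G = "arc_digraph n es"
  obtain a xs where vs: "vs = a # xs"
    using assms(3) by (cases vs) auto
  have c: "circuit vs = zip (a # xs) (xs @ [a])"
    by (simp add: circuit_def vs)
  have 1: "pre_digraph.cas ?G u (zip (u # ys) (ys @ [b])) b" for u b ys
    by (induction ys arbitrary: u) (simp_all add: pre_digraph.cas.simps)
  have 2: "pre_digraph.awalk_verts ?G u (zip (u # ys) (ys @ [b])) = u # ys @ [b]" for u b ys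
    by (induction ys arbitrary: u) (simp_all add: pre_digraph.awalk_verts.simps)
  have 3: "a < n"
    using assms(1,4) fst_circuit[of vs] by (force simp: vs)
  show ?thesis
    unfolding pre_digraph.cycle_def pre_digraph.awalk_def
  proof (intro exI[of _ a] conjI)
    show "pre_digraph.cas ?G a (circuit vs) a"
      unfolding c by (rule 1)
    show "distinct (tl (pre_digraph.awalk_verts ?G a (circuit vs)))"
      unfolding c 2 using assms(2) by (simp add: vs)
  qed (use assms(1) 3 in \<open>auto simp: circuit_def vs\<close>)
qed

section \<open>An intrinsically linked tournament\<close>

text \<open>Addition of a single element to a formal sum modulo 2, represented by the list of its support.\<close>

fun toggle :: "'a \<Rightarrow> 'a list \<Rightarrow> 'a list" where
  "toggle x [] = [x]"
| "toggle x (y # ys) = (if x = y then ys else y # toggle x ys)"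

lemma sum_toggle:
  fixes F :: "'a \<Rightarrow> bit"
  shows "(\<Sum>y\<leftarrow>toggle x ys. F y) = F x + (\<Sum>y\<leftarrow>ys. F y)"
  by (induction ys) (auto simp: ac_simps)

lemma sum_foldr_toggle:
  fixes F :: "'a \<Rightarrow> bit"
  shows "(\<Sum>y\<leftarrow>foldr toggle xs []. F y) = (\<Sum>x\<leftarrow>xs. F x)"
  by (induction xs) (simp_all add: sum_toggle)

lemma sum_list_of_bool_bit: "(\<Sum>x\<leftarrow>xs. of_bool (P x) :: bit) = of_bool (odd (length (filter P xs)))"
  by (induction xs) auto

lemma sum_list_concat: "(\<Sum>x\<leftarrow>concat xss. F x) = (\<Sum>xs\<leftarrow>xss. \<Sum>x\<leftarrow>xs. F x)"
  for F :: "'a \<Rightarrow> 'b :: comm_monoid_add"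
  by (induction xss) simp_all

lemma sum_list_product: "(\<Sum>p\<leftarrow>List.product xs ys. F p) = (\<Sum>x\<leftarrow>xs. \<Sum>y\<leftarrow>ys. F (x, y))"
  for F :: "'a \<times> 'c \<Rightarrow> 'b :: comm_monoid_add"
  by (induction xs) (simp_all add: o_def)

text \<open>The arc from 0 to 7 is the only one that leaves 0, the arcs from \<open>1, \<dots>, 6\<close> lead to 0, and 7 sends
an arc to each of them. Contracting the arc from 0 to 7 therefore gives a vertex joined in both
directions to each of \<open>1, \<dots>, 6\<close>, so that every directed path on \<open>1, \<dots>, 6\<close> closes up to a directed cycle.
Among \<open>1, \<dots>, 6\<close> there are the triangle on \<open>2, 3, 4\<close> and the circular pattern
\<open>{2, 3, 4} \<rightarrow> 1 \<rightarrow> {5, 6} \<rightarrow> {2, 3, 4}\<close>.\<close>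

definition linked_arcs :: "(nat \<times> nat) list" where
  "linked_arcs =
    [(0, 7), (1, 0), (2, 0), (3, 0), (4, 0), (5, 0), (6, 0),
     (7, 1), (7, 2), (7, 3), (7, 4), (7, 5), (7, 6),
     (2, 3), (3, 4), (4, 2), (2, 1), (3, 1), (4, 1), (1, 5), (1, 6),
     (5, 2), (5, 3), (5, 4), (6, 2), (6, 3), (6, 4), (6, 5)]"

text \<open>The family is a solution of a system of linear equations over the field with two elements: each
unordered pair of arcs has to be met an even number of times, and the number of interleaving pairs
met in the wrong order has to be odd. It is invariant under the rotation \<open>2, 3, 4\<close> and under the
exchange of 5 and 6, which accounts for the parametrization.\<close>

definition link_family :: "(nat list \<times> nat list) list" where
  "link_family =
     concat (map (\<lambda>((i, j, k), (u, u')).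
        [([0, 7, i], [1, u, k]), ([1, u, i], [0, 7, j, k]),
         ([1, u, i], [0, 7, u', j]), ([0, 7, u, i], [1, u', j, k])])
       (List.product [(2, 3, 4), (3, 4, 2), (4, 2, 3)] [(5, 6), (6, 5)])) @
     [([0, 7, 5], [2, 3, 4]), ([0, 7, 6], [2, 3, 4]),
      ([2, 3, 4], [0, 7, 1, 5]), ([2, 3, 4], [0, 7, 1, 6])]"

definition arc_pairs :: "((nat \<times> nat) \<times> (nat \<times> nat)) list" where
  "arc_pairs = concat (map (\<lambda>(c, d). List.product (circuit c) (circuit d)) link_family)"

text \<open>Arcs of disjoint cycles have different tails, which allows to order such a pair by the tails.\<close>

definition ordered :: "(nat \<times> nat) \<times> (nat \<times> nat) \<Rightarrow> (nat \<times> nat) \<times> (nat \<times> nat)" where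
  "ordered p = (if fst (fst p) < fst (snd p) then p else (snd p, fst p))"

definition swapped_crossing :: "(nat \<times> nat) \<times> (nat \<times> nat) \<Rightarrow> bool" where
  "swapped_crossing p \<longleftrightarrow> fst (snd p) < fst (fst p) \<and> interleave (fst p) (snd p) = 1"

text \<open>Each unordered pair of arcs occurs an even number of times, so that a crossing change between
two arcs changes the linking parities of an even number of members of the family.\<close>

lemma arc_pairs_cancel: "foldr toggle (map ordered arc_pairs) [] = []"
  by code_simp

lemma odd_swapped_crossings: "odd (length (filter swapped_crossing arc_pairs))"
  by code_simp

lemma is_tournament_linked_arcs: "is_tournament 8 linked_arcs"
  by code_simp

lemma score_sequence_linked_arcs: "score_sequence (arc_digraph 8 linked_arcs) = [1, 3, 3, 3, 3, 4, 5, 6]"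
proof -
  have "sort (map (\<lambda>v. length (filter (\<lambda>e. fst e = v) linked_arcs)) [0..<8]) = [1, 3, 3, 3, 3, 4, 5, 6]"
    by code_simp
  then show ?thesis
    using is_tournament_linked_arcs by (simp add: score_sequence_arc_digraph is_tournament_def)
qed

lemma link_family_valid:
  "\<forall>(c, d)\<in>set link_family. c \<noteq> [] \<and> d \<noteq> [] \<and> distinct c \<and> distinct d \<and> set c \<inter> set d = {} \<and>
     set (circuit c) \<subseteq> set linked_arcs \<and> set (circuit d) \<subseteq> set linked_arcs"
  by code_simp

text \<open>If all links of the family were split, the sum of \<open>Z\<close> over all arc pairs would be zero. Reordering the
pairs by \<open>Z e f = Z f e + interleave e f\<close> makes all values of \<open>Z\<close> cancel and leaves the odd number
of swapped crossings.\<close>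

theorem intrinsically_linked_linked_arcs: "intrinsically_linked_digraph (arc_digraph 8 linked_arcs)"
  unfolding intrinsically_linked_digraph_def
proof (intro allI impI, rule ccontr)
  let ?G = "arc_digraph 8 linked_arcs"
  fix \<phi> \<gamma>
  assume emb: "tame_embedding ?G \<phi> \<gamma>" and none: "\<not> has_nonsplit_consistent_link ?G \<gamma>"
  define S where "S = (\<lambda>(c, d). (circuit c, circuit d)) ` set link_family"
  have small: "\<forall>e\<in>set linked_arcs. fst e < 8"
    using is_tournament_linked_arcs by (simp add: is_tournament_def)
  have valid: "consistent_link ?G c d" if "(c, d) \<in> S" for c d
  proof -
    from that obtain vs ws where cd: "(vs, ws) \<in> set link_family" "c = circuit vs" "d = circuit ws"
      unfolding S_def by auto
    then have *: "vs \<noteq> []" "ws \<noteq> []" "distinct vs" "distinct ws" "set vs \<inter> set ws = {}"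
        "set (circuit vs) \<subseteq> set linked_arcs" "set (circuit ws) \<subseteq> set linked_arcs"
      using link_family_valid by auto
    show ?thesis
      unfolding consistent_link_def cd(2,3)
      using cycle_circuit[OF *(6,3,1) small] cycle_circuit[OF *(7,4,2) small] *(5) by (simp add: fst_circuit)
  qed
  have split: "split_link (embedded_cycle \<gamma> c) (embedded_cycle \<gamma> d)" if "(c, d) \<in> S" for c d
    using none valid[OF that] unfolding has_nonsplit_consistent_link_def by blast
  have "finite S"
    by (simp add: S_def)
  show False
  proof (rule overcrossing_parities_of_split_links[OF digraph_arc_digraph[OF is_tournament_linked_arcs] _ _ emb \<open>finite S\<close> valid split])
    fix Z
    assume Z: "\<And>e f. e \<in> arcs ?G \<Longrightarrow> f \<in> arcs ?G \<Longrightarrow> {fst e, snd e} \<inter> {fst f, snd f} = {} \<Longrightarrow>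
        Z e f + Z f e = interleave e f"
      and Z0: "\<And>c d. (c, d) \<in> S \<Longrightarrow> (\<Sum>e\<leftarrow>c. \<Sum>f\<leftarrow>d. Z e f) = 0"
    define F where "F p = Z (fst p) (snd p)" for p
    have "F p = F (ordered p) + of_bool (swapped_crossing p)" if pin: "p \<in> set arc_pairs" for p
    proof -
      obtain e f where p: "p = (e, f)" by (cases p)
      obtain c d where cd: "(c, d) \<in> set link_family" "e \<in> set (circuit c)" "f \<in> set (circuit d)"
        using pin unfolding p arc_pairs_def by auto
      then have *: "set c \<inter> set d = {}" "e \<in> set linked_arcs" "f \<in> set linked_arcs"
        using link_family_valid by auto
      have sub: "{fst e, snd e} \<subseteq> set c" "{fst f, snd f} \<subseteq> set d"
        using cd(2,3) set_zip_leftD[of "fst e" "snd e"] set_zip_rightD[of "fst e" "snd e"]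
          set_zip_leftD[of "fst f" "snd f"] set_zip_rightD[of "fst f" "snd f"]
        unfolding circuit_def by fastforce+
      then have dj: "{fst e, snd e} \<inter> {fst f, snd f} = {}"
        using *(1) by blast
      then have "Z e f + Z f e = interleave e f"
        using Z[of e f] * by simp
      then have "Z e f = Z f e + interleave e f"
        by (metis add.commute bit_add_left_self)
      moreover have "fst e \<noteq> fst f"
        using dj by auto
      ultimately show ?thesis
        by (cases "interleave e f") (auto simp: F_def p ordered_def swapped_crossing_def)
    qed
    then have "(\<Sum>p\<leftarrow>arc_pairs. F p) = (\<Sum>p\<leftarrow>arc_pairs. F (ordered p) + of_bool (swapped_crossing p))"
      by (intro arg_cong[of _ _ sum_list] map_cong refl)
    also have "\<dots> = (\<Sum>p\<leftarrow>map ordered arc_pairs. F p) + (\<Sum>p\<leftarrow>arc_pairs. of_bool (swapped_crossing p))"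
      by (simp add: sum_list_addf o_def)
    also have "\<dots> = 1"
      using odd_swapped_crossings
      by (subst sum_foldr_toggle[symmetric]) (simp add: arc_pairs_cancel sum_list_of_bool_bit)
    finally have "(\<Sum>p\<leftarrow>arc_pairs. F p) = 1" .
    moreover have "(\<Sum>p\<leftarrow>(case x of (c, d) \<Rightarrow> List.product (circuit c) (circuit d)). F p) = 0"
      if x: "x \<in> set link_family" for x
    proof -
      have "(circuit (fst x), circuit (snd x)) \<in> S"
        using x unfolding S_def by force
      from Z0[OF this] show ?thesis
        by (simp add: case_prod_unfold sum_list_product F_def)
    qed
    then have "(\<Sum>p\<leftarrow>arc_pairs. F p) = 0"
      unfolding arc_pairs_def sum_list_concat by (simp add: o_def cong: map_cong)
    ultimately show False
      by simp
  qed simp_all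
qed

section \<open>Stereographic projection\<close>

text \<open>Projection from a point with fourth coordinate 0. The fourth coordinate of the sphere
then corresponds to the third coordinate of \<open>\<real>\<^sup>3\<close> with the same sign, and the great sphere
\<open>x $ 4 = 0\<close> corresponds to a coordinate plane.\<close>

definition stereo :: "real ^ 4 \<Rightarrow> real ^ 3" where
  "stereo x = (\<chi> i. (if i = 1 then x $ 1 else if i = 2 then x $ 2 else x $ 4) / (1 - x $ 3))"

definition inv_stereo :: "real ^ 3 \<Rightarrow> real ^ 4" where
  "inv_stereo y = (\<chi> i. (if i = 1 then 2 * y $ 1 else if i = 2 then 2 * y $ 2
      else if i = 3 then y \<bullet> y - 1 else 2 * y $ 3) / (1 + y \<bullet> y))"

definition pole :: "real ^ 4" where
  "pole = axis 3 1"

lemma stereo_nth: "stereo x $ 1 = x $ 1 / (1 - x $ 3)" "stereo x $ 2 = x $ 2 / (1 - x $ 3)"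
    "stereo x $ 3 = x $ 4 / (1 - x $ 3)"
  by (simp_all add: stereo_def)

lemma inv_stereo_nth:
  "inv_stereo y $ 1 = 2 * y $ 1 / (1 + y \<bullet> y)" "inv_stereo y $ 2 = 2 * y $ 2 / (1 + y \<bullet> y)"
  "inv_stereo y $ 3 = (y \<bullet> y - 1) / (1 + y \<bullet> y)" "inv_stereo y $ 4 = 2 * y $ 3 / (1 + y \<bullet> y)"
  by (simp_all add: inv_stereo_def)

lemma inner_3: "(y :: real ^ 3) \<bullet> y = (y $ 1)\<^sup>2 + (y $ 2)\<^sup>2 + (y $ 3)\<^sup>2"
  by (simp add: inner_vec_def sum_3 power2_eq_square)

lemma inner_4: "(x :: real ^ 4) \<bullet> x = (x $ 1)\<^sup>2 + (x $ 2)\<^sup>2 + (x $ 3)\<^sup>2 + (x $ 4)\<^sup>2"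
  by (simp add: inner_vec_def sum_4 power2_eq_square)

lemma S3_iff: "x \<in> S3 \<longleftrightarrow> (x $ 1)\<^sup>2 + (x $ 2)\<^sup>2 + (x $ 3)\<^sup>2 + (x $ 4)\<^sup>2 = 1"
  unfolding inner_4[symmetric] by (simp add: norm_eq_1)

lemma pole_S3: "pole \<in> S3"
  by (simp add: pole_def)

lemma S3_minus_pole: "x \<in> S3 - {pole} \<longleftrightarrow> x \<in> S3 \<and> x $ 3 \<noteq> 1"
proof -
  have "x = pole" if "x \<in> S3" "x $ 3 = 1"
  proof -
    have "(x $ 1)\<^sup>2 + (x $ 2)\<^sup>2 + (x $ 4)\<^sup>2 = 0"
      using that(1) unfolding S3_iff that(2) by simp
    then have "x $ 1 = 0" "x $ 2 = 0" "x $ 4 = 0"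
      by (simp_all add: add_nonneg_eq_0_iff)
    then show ?thesis
      using that(2) by (simp add: vec_eq_iff forall_4 pole_def axis_def)
  qed
  moreover have "pole $ 3 = 1"
    by (simp add: pole_def axis_def)
  ultimately show ?thesis by blast
qed

lemma inner_pos: "1 + (y :: real ^ 3) \<bullet> y > 0"
  by (simp add: add_pos_nonneg)

lemma inv_stereo_in: "inv_stereo y \<in> S3 - {pole}"
proof -
  define r where "r = y \<bullet> y"
  have r: "1 + r > 0"
    using inner_pos by (simp add: r_def)
  have "(2 * y $ 1)\<^sup>2 + (2 * y $ 2)\<^sup>2 + (r - 1)\<^sup>2 + (2 * y $ 3)\<^sup>2 = 4 * r + (r - 1)\<^sup>2"
    by (simp add: r_def inner_3 power_mult_distrib)
  also have "\<dots> = (1 + r)\<^sup>2"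
    by (simp add: power2_eq_square algebra_simps)
  finally have "inv_stereo y \<in> S3"
    unfolding S3_iff inv_stereo_nth r_def[symmetric] power_divide add_divide_distrib[symmetric]
    using r by simp
  moreover have "inv_stereo y $ 3 \<noteq> 1"
    using r unfolding inv_stereo_nth r_def[symmetric] by (simp add: field_simps)
  ultimately show ?thesis
    using S3_minus_pole by blast
qed

lemma stereo_inv_stereo: "stereo (inv_stereo y) = y"
proof -
  define r where "r = y \<bullet> y"
  have r: "1 + r > 0"
    using inner_pos by (simp add: r_def)
  have d: "1 - inv_stereo y $ 3 = 2 / (1 + r)"
    using r unfolding inv_stereo_nth r_def[symmetric] by (simp add: field_simps)
  show ?thesis
    unfolding vec_eq_iff forall_3 stereo_nth d using r
    by (simp add: inv_stereo_nth r_def[symmetric])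
qed

lemma inv_stereo_stereo:
  assumes "x \<in> S3 - {pole}"
  shows "inv_stereo (stereo x) = x"
proof -
  define d where "d = 1 - x $ 3"
  have x3: "x $ 3 = 1 - d"
    by (simp add: d_def)
  have d: "d \<noteq> 0" and sq: "(x $ 1)\<^sup>2 + (x $ 2)\<^sup>2 + (x $ 4)\<^sup>2 = d * (2 - d)"
    using assms unfolding S3_minus_pole S3_iff by (auto simp: d_def power2_eq_square algebra_simps)
  have "stereo x \<bullet> stereo x = ((x $ 1)\<^sup>2 + (x $ 2)\<^sup>2 + (x $ 4)\<^sup>2) / d\<^sup>2"
    unfolding inner_3 stereo_nth d_def[symmetric] by (simp add: power_divide add_divide_distrib)
  also have "\<dots> = (2 - d) / d"
    unfolding sq using d by (simp add: power2_eq_square)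
  finally have r: "stereo x \<bullet> stereo x = (2 - d) / d" .
  have r1: "1 + stereo x \<bullet> stereo x = 2 / d"
    unfolding r using d by (simp add: field_simps)
  show ?thesis
    unfolding vec_eq_iff forall_4 inv_stereo_nth r1 unfolding r stereo_nth d_def[symmetric] x3
    using d by (simp add: field_simps)
qed

lemma homeomorphism_stereo: "homeomorphism (S3 - {pole}) UNIV stereo inv_stereo"
proof (rule homeomorphismI)
  have nz: "1 - x $ 3 \<noteq> 0" if "x \<in> S3 - {pole}" for x
    using that unfolding S3_minus_pole by simp
  show "continuous_on (S3 - {pole}) stereo"
    unfolding stereo_def
  proof (rule continuous_on_vec_lambda)
    fix i :: 3
    have "continuous_on (S3 - {pole}) (\<lambda>x. if i = 1 then x $ 1 else if i = 2 then x $ 2 else x $ 4)"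
      by (cases "i = 1"; cases "i = 2") (simp_all add: continuous_on_component continuous_on_id)
    then show "continuous_on (S3 - {pole}) (\<lambda>x. (if i = 1 then x $ 1 else if i = 2 then x $ 2 else x $ 4) / (1 - x $ 3))"
      by (rule continuous_on_divide) (intro continuous_intros, use nz in blast)
  qed
  have "1 + y \<bullet> y \<noteq> 0" for y :: "real ^ 3"
    using inner_pos[of y] by simp
  show "continuous_on UNIV inv_stereo"
    unfolding inv_stereo_def
  proof (intro continuous_on_vec_lambda)
    fix i :: 4
    have "continuous_on UNIV (\<lambda>y :: real ^ 3. if i = 1 then 2 * y $ 1 else if i = 2 then 2 * y $ 2
        else if i = 3 then y \<bullet> y - 1 else 2 * y $ 3)"
      by (cases "i = 1"; cases "i = 2"; cases "i = 3") (simp_all, (intro continuous_intros)+)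
    then show "continuous_on UNIV (\<lambda>y :: real ^ 3. (if i = 1 then 2 * y $ 1 else if i = 2 then 2 * y $ 2
        else if i = 3 then y \<bullet> y - 1 else 2 * y $ 3) / (1 + y \<bullet> y))"
      by (rule continuous_on_divide) (intro continuous_intros, use \<open>\<And>y. 1 + y \<bullet> y \<noteq> 0\<close> in blast)
  qed
  show "inv_stereo ` UNIV \<subseteq> S3 - {pole}"
    by (rule image_subsetI) (rule inv_stereo_in)
qed (simp_all add: stereo_inv_stereo inv_stereo_stereo)

section \<open>Straight embeddings on the moment curve\<close>

text \<open>The moment curve, with the parameter as the third coordinate: the sign of the parameter decides
on which side of the great sphere a vertex lies.\<close>

definition moment :: "real \<Rightarrow> real ^ 3" where
  "moment t = vector [t ^ 2, t ^ 3, t]"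

lemma moment_nth: "moment t $ 1 = t ^ 2" "moment t $ 2 = t ^ 3" "moment t $ 3 = t"
  by (simp_all add: moment_def)

lemma inj_moment: "moment s = moment t \<longleftrightarrow> s = t"
  by (metis moment_nth(3))

text \<open>A relation between points of the moment curve is a relation between the values of all polynomials
of degree at most 3; suitable zeros isolate single coefficients.\<close>

lemma moment_cubic:
  assumes "(1 - s) *\<^sub>R moment a + s *\<^sub>R moment b = (1 - r) *\<^sub>R moment c + r *\<^sub>R moment d"
  shows "(1 - s) * ((a - u) * (a - v) * (a - w)) + s * ((b - u) * (b - v) * (b - w)) =
    (1 - r) * ((c - u) * (c - v) * (c - w)) + r * ((d - u) * (d - v) * (d - w))"
proof -
  have expand: "(1 - s) * ((a - u) * (a - v) * (a - w)) + s * ((b - u) * (b - v) * (b - w)) =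
      ((1 - s) * a ^ 3 + s * b ^ 3) - (u + v + w) * ((1 - s) * a ^ 2 + s * b ^ 2) +
      (u * v + u * w + v * w) * ((1 - s) * a + s * b) - u * v * w" for s a b :: real
    by (simp add: algebra_simps power2_eq_square power3_eq_cube)
  have "(1 - s) * a ^ 2 + s * b ^ 2 = (1 - r) * c ^ 2 + r * d ^ 2"
    "(1 - s) * a ^ 3 + s * b ^ 3 = (1 - r) * c ^ 3 + r * d ^ 3"
    "(1 - s) * a + s * b = (1 - r) * c + r * d"
    using arg_cong[OF assms, of "\<lambda>x. x $ 1"] arg_cong[OF assms, of "\<lambda>x. x $ 2"] arg_cong[OF assms, of "\<lambda>x. x $ 3"]
    by (simp_all add: moment_nth)
  then show ?thesis
    unfolding expand by simp
qed

lemma moment_segments_disjoint: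
  assumes "distinct [a, b, c, d]"
  shows "closed_segment (moment a) (moment b) \<inter> closed_segment (moment c) (moment d) = {}"
proof (rule ccontr)
  assume "\<not> ?thesis"
  then obtain s r where "(1 - s) *\<^sub>R moment a + s *\<^sub>R moment b = (1 - r) *\<^sub>R moment c + r *\<^sub>R moment d"
    unfolding closed_segment_def by auto
  note cubic = moment_cubic[OF this]
  have "(1 - s) * ((a - b) * (a - c) * (a - d)) = 0"
    using cubic[of b c d] by simp
  moreover have "s * ((b - a) * (b - c) * (b - d)) = 0"
    using cubic[of a c d] by simp
  ultimately show False
    using assms by auto
qed

lemma moment_segments_common_end:
  assumes "distinct [a, b, d]"
  shows "closed_segment (moment a) (moment b) \<inter> closed_segment (moment a) (moment d) \<subseteq> {moment a}"
proof
  fix x assume "x \<in> closed_segment (moment a) (moment b) \<inter> closed_segment (moment a) (moment d)"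
  then have "x \<in> closed_segment (moment a) (moment b)" "x \<in> closed_segment (moment a) (moment d)"
    by simp_all
  then obtain s r where x: "x = (1 - s) *\<^sub>R moment a + s *\<^sub>R moment b"
    and "x = (1 - r) *\<^sub>R moment a + r *\<^sub>R moment d"
    unfolding in_segment by blast
  then have "(1 - s) *\<^sub>R moment a + s *\<^sub>R moment b = (1 - r) *\<^sub>R moment a + r *\<^sub>R moment d"
    by simp
  from moment_cubic[OF this, of a a d] have "s * ((b - a) * (b - a) * (b - d)) = 0"
    by simp
  then have "s = 0"
    using assms by auto
  then show "x \<in> {moment a}"
    by (simp add: x)
qed

lemma moment_notin_segment:
  assumes "distinct [a, b, c]"
  shows "moment c \<notin> closed_segment (moment a) (moment b)"
proof
  assume "moment c \<in> closed_segment (moment a) (moment b)"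
  then have "moment c \<in> {moment a}"
    using moment_segments_common_end[of a b c] assms by auto
  then show False
    using assms inj_moment by auto
qed

lemma moment_segments_Int:
  assumes "a \<noteq> b" "c \<noteq> d" "{a, b} \<noteq> {c, d}"
  shows "closed_segment (moment a) (moment b) \<inter> closed_segment (moment c) (moment d) \<subseteq> moment ` {a, b}"
proof (cases "{a, b} \<inter> {c, d} = {}")
  case True
  then show ?thesis
    using moment_segments_disjoint[of a b c d] assms by auto
next
  case False
  then consider "a = c" "b \<noteq> d" | "a = d" "b \<noteq> c" | "b = c" "a \<noteq> d" | "b = d" "a \<noteq> c"
    using assms(3) by auto
  then show ?thesis
  proof cases
    case 1
    then show ?thesis using moment_segments_common_end[of a b d] assms by auto
  next
    case 2
    then show ?thesis
      unfolding closed_segment_commute[of "moment c" "moment d"]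
      using moment_segments_common_end[of a b c] assms by auto
  next
    case 3
    then show ?thesis
      unfolding closed_segment_commute[of "moment a" "moment b"]
      using moment_segments_common_end[of b a d] assms by auto
  next
    case 4
    then show ?thesis
      unfolding closed_segment_commute[of "moment a" "moment b"] closed_segment_commute[of "moment c" "moment d"]
      using moment_segments_common_end[of b a c] assms by auto
  qed
qed

definition moment_vertex :: "(nat \<Rightarrow> real) \<Rightarrow> nat \<Rightarrow> real ^ 4" where
  "moment_vertex t v = inv_stereo (moment (t v))"

definition moment_arc :: "(nat \<Rightarrow> real) \<Rightarrow> nat \<times> nat \<Rightarrow> real \<Rightarrow> real ^ 4" where
  "moment_arc t e = inv_stereo \<circ> linepath (moment (t (fst e))) (moment (t (snd e)))"

lemma path_image_moment_arc:
  "path_image (moment_arc t e) = inv_stereo ` closed_segment (moment (t (fst e))) (moment (t (snd e)))"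
  by (simp add: moment_arc_def path_image_compose)

lemma inj_inv_stereo: "inj_on inv_stereo X"
  by (rule inj_on_inverseI) (rule stereo_inv_stereo)

lemma moment_arcs_Int:
  assumes T: "is_tournament n es" and t: "inj_on t {0..<n}"
    and e: "e \<in> set es" and f: "f \<in> set es" and ne: "e \<noteq> f"
  shows "path_image (moment_arc t e) \<inter> path_image (moment_arc t f) \<subseteq> moment_vertex t ` {fst e, snd e}"
proof -
  have lt: "fst e < n" "snd e < n" "fst f < n" "snd f < n" and loop: "fst e \<noteq> snd e" "fst f \<noteq> snd f"
    using T e f by (auto simp: is_tournament_def)
  have "\<not> ((fst e, snd e) \<in> set es \<and> (snd e, fst e) \<in> set es)"
    using T lt(1,2) loop(1) unfolding is_tournament_def by auto
  then have "f \<noteq> (snd e, fst e)"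
    using e f by auto
  then have "{fst e, snd e} \<noteq> {fst f, snd f}"
    using ne by (auto simp: doubleton_eq_iff prod_eq_iff)
  then have "t ` {fst e, snd e} \<noteq> t ` {fst f, snd f}"
    using inj_on_image_eq_iff[OF t, of "{fst e, snd e}" "{fst f, snd f}"] lt by simp
  then have "closed_segment (moment (t (fst e))) (moment (t (snd e))) \<inter>
      closed_segment (moment (t (fst f))) (moment (t (snd f))) \<subseteq> moment ` {t (fst e), t (snd e)}"
    using lt loop inj_onD[OF t] by (intro moment_segments_Int) auto
  then show ?thesis
    unfolding path_image_moment_arc image_Int[OF inj_inv_stereo, symmetric] moment_vertex_def by auto
qed

lemma moment_arc_vertices:
  assumes t: "inj_on t V" and e: "fst e \<in> V" "snd e \<in> V" "fst e \<noteq> snd e"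
  shows "path_image (moment_arc t e) \<inter> moment_vertex t ` V = moment_vertex t ` {fst e, snd e}"
proof
  show "path_image (moment_arc t e) \<inter> moment_vertex t ` V \<subseteq> moment_vertex t ` {fst e, snd e}"
  proof
    fix x assume "x \<in> path_image (moment_arc t e) \<inter> moment_vertex t ` V"
    then obtain v y where v: "v \<in> V" "x = inv_stereo (moment (t v))" "x = inv_stereo y"
      and y: "y \<in> closed_segment (moment (t (fst e))) (moment (t (snd e)))"
      unfolding path_image_moment_arc moment_vertex_def by blast
    have "moment (t v) = y"
      using arg_cong[OF v(2)[unfolded v(3)], of stereo] by (simp add: stereo_inv_stereo)
    then have "\<not> distinct [t (fst e), t (snd e), t v]"
      using y moment_notin_segment by blast
    then have "v \<in> {fst e, snd e}"
      using inj_onD[OF t] v(1) e by auto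
    then show "x \<in> moment_vertex t ` {fst e, snd e}"
      using v(2) by (auto simp: moment_vertex_def)
  qed
  show "moment_vertex t ` {fst e, snd e} \<subseteq> path_image (moment_arc t e) \<inter> moment_vertex t ` V"
    using e by (auto simp: path_image_moment_arc moment_vertex_def)
qed

text \<open>No four points of the moment curve lie in a plane, so that segments between them meet only in
common end points. Degenerate segments are added for the vertices, which covers isolated ones.\<close>

proposition tame_moment_embedding:
  assumes T: "is_tournament n es" and t: "inj_on t {0..<n}"
  shows "tame_embedding (arc_digraph n es) (moment_vertex t) (moment_arc t)"
proof -
  have es: "fst e < n" "snd e < n" "fst e \<noteq> snd e" if "e \<in> set es" for e
    using T that by (auto simp: is_tournament_def)
  have cont: "continuous_on X inv_stereo" for X
  proof (rule continuous_on_subset)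
    show "continuous_on UNIV inv_stereo"
      using homeomorphism_stereo by (simp add: homeomorphism_def)
  qed simp
  have "spatial_embedding (arc_digraph n es) (moment_vertex t) (moment_arc t)"
    unfolding spatial_embedding_def arc_digraph_simps
  proof (intro conjI ballI impI)
    show "inj_on (moment_vertex t) {0..<n}"
    proof (rule inj_onI)
      fix u v assume uv: "u \<in> {0..<n}" "v \<in> {0..<n}" "moment_vertex t u = moment_vertex t v"
      from arg_cong[OF uv(3), of stereo] have "t u = t v"
        by (simp add: moment_vertex_def stereo_inv_stereo inj_moment)
      then show "u = v"
        using inj_onD[OF t] uv(1,2) by simp
    qed
    show "moment_vertex t ` {0..<n} \<subseteq> S3"
      unfolding moment_vertex_def using inv_stereo_in by blast
  next
    fix e assume e: "e \<in> set es"
    have "t (fst e) \<noteq> t (snd e)"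
      using es[OF e] inj_onD[OF t, of "fst e" "snd e"] by auto
    then have "arc (linepath (moment (t (fst e))) (moment (t (snd e))))"
      by (intro arc_linepath) (simp add: inj_moment)
    then show "simple_path (moment_arc t e)"
      unfolding moment_arc_def
      by (intro simple_path_continuous_image cont inj_inv_stereo arc_imp_simple_path)
    show "path_image (moment_arc t e) \<subseteq> S3"
      unfolding path_image_moment_arc using inv_stereo_in by blast
    show "pathstart (moment_arc t e) = moment_vertex t (fst e)" "pathfinish (moment_arc t e) = moment_vertex t (snd e)"
      by (simp_all add: moment_arc_def moment_vertex_def pathstart_compose pathfinish_compose)
    show "path_image (moment_arc t e) \<inter> moment_vertex t ` {0..<n} = {moment_vertex t (fst e), moment_vertex t (snd e)}"
      using moment_arc_vertices[OF t, of e] es[OF e] by simp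
  next
    fix e f assume "e \<in> set es" "f \<in> set es" "e \<noteq> f"
    then show "path_image (moment_arc t e) \<inter> path_image (moment_arc t f) \<subseteq> moment_vertex t ` {0..<n}"
      using moment_arcs_Int[OF T t, of e f] es[of e] by fastforce
  qed
  moreover have "tame_1dim (moment_vertex t ` {0..<n} \<union> (\<Union>e \<in> set es. path_image (moment_arc t e)))"
    (is "tame_1dim ?X")
  proof -
    define F where "F = (\<lambda>v. (moment (t v), moment (t v))) ` {0..<n} \<union>
      (\<lambda>e. (moment (t (fst e)), moment (t (snd e)))) ` set es"
    have X: "?X = inv_stereo ` (\<Union>(a, b)\<in>F. closed_segment a b)"
      unfolding F_def by (auto simp: path_image_moment_arc moment_vertex_def)
    have "?X \<subseteq> S3 - {pole}"
      unfolding X by (rule image_subsetI) (rule inv_stereo_in)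
    moreover have "stereo ` ?X = (\<Union>(a, b)\<in>F. closed_segment a b)"
      unfolding X image_image stereo_inv_stereo by simp
    moreover have "finite F"
      by (simp add: F_def)
    ultimately show ?thesis
      unfolding tame_1dim_def using pole_S3 homeomorphism_stereo by blast
  qed
  ultimately show ?thesis
    by (simp add: tame_embedding_def)
qed

lemma split_link_sym: "split_link A B \<Longrightarrow> split_link B A"
  unfolding split_link_def by (meson connected_component_sym)

lemma split_by_equator:
  assumes "A \<subseteq> {x \<in> S3. x $ 4 < 0}" "B \<subseteq> {x \<in> S3. 0 < x $ 4}"
  shows "split_link A B"
proof -
  let ?\<Sigma> = "{x \<in> S3. x $ 4 = 0}"
  have "tame_2sphere ?\<Sigma>"
    unfolding tame_2sphere_def by (intro exI[of _ "\<lambda>x. x"] conjI homeomorphism_ident) simp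
  moreover have "\<not> connected_component (S3 - ?\<Sigma>) a b" if "a \<in> A" "b \<in> B" for a b
  proof
    assume "connected_component (S3 - ?\<Sigma>) a b"
    then obtain C where C: "connected C" "C \<subseteq> S3 - ?\<Sigma>" "a \<in> C" "b \<in> C"
      unfolding connected_component_def by blast
    moreover have "a $ 4 \<le> 0" "0 \<le> b $ 4"
      using assms that by force+
    ultimately obtain z where "z \<in> C" "z $ 4 = 0"
      using connected_ivt_component_cart[OF C(1,3,4), of 4 0] by blast
    with C(2) show False
      by blast
  qed
  moreover have "A \<subseteq> S3 - ?\<Sigma>" "B \<subseteq> S3 - ?\<Sigma>"
    using assms by auto
  ultimately show ?thesis
    unfolding split_link_def by blast
qed

lemma moment_arc_side:
  assumes "x \<in> path_image (moment_arc t e)"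
  shows "x \<in> S3" "t (fst e) < 0 \<Longrightarrow> t (snd e) < 0 \<Longrightarrow> x $ 4 < 0" "0 < t (fst e) \<Longrightarrow> 0 < t (snd e) \<Longrightarrow> 0 < x $ 4"
proof -
  obtain y where y: "x = inv_stereo y" "y \<in> closed_segment (moment (t (fst e))) (moment (t (snd e)))"
    using assms unfolding path_image_moment_arc by blast
  then obtain s where s: "0 \<le> s" "s \<le> 1" "y $ 3 = (1 - s) * t (fst e) + s * t (snd e)"
    unfolding in_segment by (auto simp: moment_nth)
  have "closed_segment (t (fst e)) (t (snd e)) \<subseteq> C" if "convex C" "t (fst e) \<in> C" "t (snd e) \<in> C" for C
    using that by (simp add: closed_segment_subset)
  moreover have "y $ 3 \<in> closed_segment (t (fst e)) (t (snd e))"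
    using s unfolding in_segment by auto
  ultimately have side: "y $ 3 \<in> C" if "convex C" "t (fst e) \<in> C" "t (snd e) \<in> C" for C
    using that by blast
  show "x \<in> S3"
    using y(1) inv_stereo_in by blast
  show "x $ 4 < 0" if "t (fst e) < 0" "t (snd e) < 0"
    using side[of "{..<0}"] that inner_pos[of y] by (simp add: y(1) inv_stereo_nth divide_less_0_iff)
  show "0 < x $ 4" if "0 < t (fst e)" "0 < t (snd e)"
    using side[of "{0<..}"] that inner_pos[of y] by (simp add: y(1) inv_stereo_nth)
qed

section \<open>A tournament with a split embedding\<close>

text \<open>The triangle on \<open>1, 3, 4\<close> sends arcs to 0 and 2, the only arc that leaves 0 leads to 2, and 2 sends arcs
to \<open>5, 6, 7\<close>, which are transitively ordered and send arcs to all of \<open>0, 1, 3, 4\<close>.\<close>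

definition unlinked_arcs :: "(nat \<times> nat) list" where
  "unlinked_arcs =
    [(1, 4), (4, 3), (3, 1), (1, 0), (3, 0), (4, 0), (1, 2), (3, 2), (4, 2),
     (0, 2), (2, 5), (2, 6), (2, 7), (6, 5), (7, 5), (7, 6),
     (5, 0), (5, 1), (5, 3), (5, 4), (6, 0), (6, 1), (6, 3), (6, 4), (7, 0), (7, 1), (7, 3), (7, 4)]"

lemma is_tournament_unlinked_arcs: "is_tournament 8 unlinked_arcs"
  by code_simp

lemma score_sequence_unlinked_arcs: "score_sequence (arc_digraph 8 unlinked_arcs) = [1, 3, 3, 3, 3, 4, 5, 6]"
proof -
  have "sort (map (\<lambda>v. length (filter (\<lambda>e. fst e = v) unlinked_arcs)) [0..<8]) = [1, 3, 3, 3, 3, 4, 5, 6]"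
    by code_simp
  then show ?thesis
    using is_tournament_unlinked_arcs by (simp add: score_sequence_arc_digraph is_tournament_def)
qed

text \<open>Without 2 the vertex 0 has no successor, and \<open>7, 6, 5\<close> have no predecessor once the earlier ones in
this list are removed.\<close>

lemma cycle_avoiding_2:
  assumes V: "V \<noteq> {}" "2 \<notin> V"
    and succ: "\<And>v. v \<in> V \<Longrightarrow> \<exists>w\<in>V. (v, w) \<in> set unlinked_arcs"
    and pred: "\<And>v. v \<in> V \<Longrightarrow> \<exists>u\<in>V. (u, v) \<in> set unlinked_arcs"
  shows "V = {1, 3, 4}"
proof -
  have 0: "0 \<notin> V"
    using succ[of 0] V(2) by (auto simp: unlinked_arcs_def)
  have 7: "7 \<notin> V"
    using pred[of 7] V(2) by (auto simp: unlinked_arcs_def)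
  have 6: "6 \<notin> V"
    using pred[of 6] V(2) 7 by (auto simp: unlinked_arcs_def)
  have 5: "5 \<notin> V"
    using pred[of 5] V(2) 6 7 by (auto simp: unlinked_arcs_def)
  have "v \<in> {0, 1, 2, 3, 4, 5, 6, 7}" if "v \<in> V" for v
    using succ[OF that] by (auto simp: unlinked_arcs_def)
  then have sub: "V \<subseteq> {1, 3, 4}"
    using V(2) 0 5 6 7 by blast
  have "1 \<in> V \<Longrightarrow> 4 \<in> V" "4 \<in> V \<Longrightarrow> 3 \<in> V" "3 \<in> V \<Longrightarrow> 1 \<in> V"
    using succ[of 1] succ[of 4] succ[of 3] 0 V(2) by (auto simp: unlinked_arcs_def)
  then show ?thesis
    using sub V(1) by blast
qed

lemma cycle_vertices:
  assumes "pre_digraph.cycle (arc_digraph n es) c"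
  shows "c \<noteq> []" "set c \<subseteq> set es" "snd ` set c = fst ` set c"
    "v \<in> fst ` set c \<Longrightarrow> \<exists>w\<in>fst ` set c. (v, w) \<in> set es"
    "v \<in> fst ` set c \<Longrightarrow> \<exists>u\<in>fst ` set c. (u, v) \<in> set es"
proof -
  show "c \<noteq> []" and sub: "set c \<subseteq> set es"
    using assms by (auto simp: pre_digraph.cycle_def pre_digraph.awalk_def)
  show heads: "snd ` set c = fst ` set c"
    using pre_digraph.cycle_heads_eq_tails[OF assms] by simp
  show "\<exists>w\<in>fst ` set c. (v, w) \<in> set es" if "v \<in> fst ` set c"
    using that sub heads by force
  show "\<exists>u\<in>fst ` set c. (u, v) \<in> set es" if "v \<in> fst ` set c"
  proof -
    have "v \<in> snd ` set c"
      using that heads by simp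
    then obtain e where "e \<in> set c" "v = snd e"
      by blast
    with sub show ?thesis
      by (intro bexI[of _ "fst e"]) auto
  qed
qed

text \<open>The shift by 1 keeps the vertex 0 off the plane and the parameters of the other vertices positive.\<close>

definition curve_parameter :: "nat \<Rightarrow> real" where
  "curve_parameter v = (if v \<in> {1, 3, 4} then - real v else real v + 1)"

lemma embedded_cycle_side:
  assumes c: "pre_digraph.cycle (arc_digraph n es) c"
  shows "fst ` set c \<subseteq> {1, 3, 4} \<Longrightarrow> embedded_cycle (moment_arc curve_parameter) c \<subseteq> {x \<in> S3. x $ 4 < 0}"
    and "fst ` set c \<inter> {1, 3, 4} = {} \<Longrightarrow> embedded_cycle (moment_arc curve_parameter) c \<subseteq> {x \<in> S3. 0 < x $ 4}"
proof -
  have ends: "fst e \<in> fst ` set c" "snd e \<in> fst ` set c" if "e \<in> set c" for e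
    using that cycle_vertices(3)[OF c] by auto
  have neg: "curve_parameter v < 0" if "v \<in> {1, 3, 4}" for v
    using that by (auto simp: curve_parameter_def)
  have pos: "0 < curve_parameter v" if "v \<notin> {1, 3, 4}" for v
    using that by (auto simp: curve_parameter_def)
  show "embedded_cycle (moment_arc curve_parameter) c \<subseteq> {x \<in> S3. x $ 4 < 0}" if "fst ` set c \<subseteq> {1, 3, 4}"
    unfolding embedded_cycle_def using moment_arc_side(1,2) neg ends that by blast
  show "embedded_cycle (moment_arc curve_parameter) c \<subseteq> {x \<in> S3. 0 < x $ 4}" if "fst ` set c \<inter> {1, 3, 4} = {}"
    unfolding embedded_cycle_def using moment_arc_side(1,3) pos ends that by blast
qed

text \<open>Of two disjoint cycles one avoids 2.\<close>

lemma unlinked_arcs_split: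
  assumes "consistent_link (arc_digraph 8 unlinked_arcs) c d"
  shows "split_link (embedded_cycle (moment_arc curve_parameter) c) (embedded_cycle (moment_arc curve_parameter) d)"
proof -
  let ?G = "arc_digraph 8 unlinked_arcs"
  have c: "pre_digraph.cycle ?G c" and d: "pre_digraph.cycle ?G d" and dj: "fst ` set c \<inter> fst ` set d = {}"
    using assms by (auto simp: consistent_link_def)
  have *: "fst ` set c = {1, 3, 4}" if "pre_digraph.cycle ?G c" "2 \<notin> fst ` set c" for c
    using cycle_vertices[OF that(1)] that(2) by (intro cycle_avoiding_2) auto
  show ?thesis
  proof (cases "2 \<in> fst ` set c")
    case False
    then show ?thesis
      using *[OF c] dj by (intro split_by_equator embedded_cycle_side[OF c] embedded_cycle_side[OF d]) auto
  next
    case True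
    then have "2 \<notin> fst ` set d"
      using dj by blast
    then show ?thesis
      using *[OF d] dj by (intro split_link_sym[OF split_by_equator] embedded_cycle_side[OF c] embedded_cycle_side[OF d]) auto
  qed
qed

theorem proposition5p2:
  shows "(\<exists>T :: (nat, nat \<times> nat) pre_digraph.
            tournament T \<and> card (verts T) = 8 \<and>
            score_sequence T = [1, 3, 3, 3, 3, 4, 5, 6] \<and>
            intrinsically_linked_digraph T) \<and>
         (\<exists>T' :: (nat, nat \<times> nat) pre_digraph.
            tournament T' \<and> card (verts T') = 8 \<and>
            score_sequence T' = [1, 3, 3, 3, 3, 4, 5, 6] \<and>
            (\<exists>\<phi> \<gamma>. tame_embedding T' \<phi> \<gamma> \<and> \<not> has_nonsplit_consistent_link T' \<gamma>))"
proof
  show "\<exists>T :: (nat, nat \<times> nat) pre_digraph.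
      tournament T \<and> card (verts T) = 8 \<and> score_sequence T = [1, 3, 3, 3, 3, 4, 5, 6] \<and>
      intrinsically_linked_digraph T"
    using tournament_arc_digraph[OF is_tournament_linked_arcs] score_sequence_linked_arcs intrinsically_linked_linked_arcs
    by (intro exI[of _ "arc_digraph 8 linked_arcs"]) simp
  have "inj_on curve_parameter {0..<8}"
    by (auto simp: inj_on_def curve_parameter_def split: if_splits)
  note emb = tame_moment_embedding[OF is_tournament_unlinked_arcs this]
  have "\<not> has_nonsplit_consistent_link (arc_digraph 8 unlinked_arcs) (moment_arc curve_parameter)"
    unfolding has_nonsplit_consistent_link_def using unlinked_arcs_split by blast
  then show "\<exists>T' :: (nat, nat \<times> nat) pre_digraph.
      tournament T' \<and> card (verts T') = 8 \<and> score_sequence T' = [1, 3, 3, 3, 3, 4, 5, 6] \<and>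
      (\<exists>\<phi> \<gamma>. tame_embedding T' \<phi> \<gamma> \<and> \<not> has_nonsplit_consistent_link T' \<gamma>)"
    using tournament_arc_digraph[OF is_tournament_unlinked_arcs] score_sequence_unlinked_arcs emb
    by (intro exI[of _ "arc_digraph 8 unlinked_arcs"]) auto
qed

end
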